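(* Let $(X,\mathcal{F})$ be a measurable space with a $\sigma$-finite measure $\mu$, and let $\{p(x|\theta):\theta\in\Theta\}$, $\Theta\subset\mathbb{R}^d$, be a family of probability densities with respect to $\mu$. For $z^k=(z_1,\dots,z_k)\in X^k$ write $p(z^k|\theta)=\prod_{i=1}^k p(z_i|\theta)$, and assume a maximum likelihood estimator $\hat\theta(z^k)\in\Theta$ (a maximizer of $\theta\mapsto p(z^k|\theta)$) exists for every $k\in\mathbb{N}$ and every $z^k\in X^k$; for $x^N\in X^N$, $y^M\in X^M$ write $\hat\theta(x^N,y^M)$ for the MLE based on the concatenated sample of size $N+M$. Let $K$ be a compact subset of the interior of $\Theta$ such that $p(z|\theta)>0$ for all $z\in X$, $\theta\in K$, and let $\delta>0$ be such that $K_\delta=\{\tilde\theta\in\Theta:\exists\theta\in K,\ |\theta-\tilde\theta|\le\delta\}$ is contained in the interior of $\Theta$. Assume the following conditions. (A1) There exist a measurable $L:X\to\mathbb{R}_+$ and $\alpha\in[1,\infty]$ such that $|\log p(z|\theta_1)-\log p(z|\theta_2)|\le L(z)|\theta_1-\theta_2|$ for all $z\in X$ and $\theta_1,\theta_2\in K_\delta$, and $\sup_{\theta\in K}\int_X p(z|\theta)L(z)^\alpha\,d\mu(z)<\infty$ (for $\alpha=\infty$ this means $\operatorname{ess\,sup}_z L(z)<\infty$). (A2) With $\beta\ge1$ defined by $1/\alpha+1/\beta=1$: $\lim_{k\to\infty}\sup_{\theta\in K}\int_{X^k}p(z^k|\theta)|\hat\theta(z^k)-\theta|^\beta\,d\mu(z^k)=0$.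 (A3) There exist a measurable $T:X\to\mathbb{R}_+$ and $r\in(1,\infty]$ such that $\sup_{\theta\in K}\{\log p(z|\hat\theta(z))-\log p(z|\theta)\}\le T(z)$ for all $z\in X$ and $\sup_{\theta\in K}\int_X p(z|\theta)T(z)^r\,d\mu(z)<\infty$. (A4) $\lim_{k\to\infty}\sup_{\theta\in K}\left|\int_{X^k}p(z^k|\theta)\log\frac{p(z^k|\hat\theta(z^k))}{p(z^k|\theta)}\,d\mu(z^k)-\frac d2\right|=0$. (A5) For the fixed $N$ there exist constants $C^{N,M}$ not depending on $\theta$ such that $\lim_{M\to\infty}\sup_{\theta\in K}\left|\int_{X^N}p(x^N|\theta)\log\left(\int_{X^M}p(y^M|\hat\theta(x^N,y^M))\,d\mu(y^M)\right)d\mu(x^N)-C^{N,M}\right|=0$. Then, for fixed $N$, $$\lim_{M\to\infty}\sup_{\pi\in\mathcal{P}_K}\left|D^{N,M}_{K,q_{\mathrm{CNML3}}}(\pi)+R^{N,M}_{\mathrm{KL}}(\pi,p_\pi)-\tilde C^{N,M}\right|=0,$$ where $\tilde C^{N,M}=C^{N,M}-d/2$ does not depend on $\pi$.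
   Context: $\mathcal{P}_K$ denotes the set of all probability measures on $\Theta$ whose support is contained in $K$. For $\pi\in\mathcal{P}_K$, $p_\pi(x^k)=\int_\Theta p(x^k|\theta)\,d\pi(\theta)$ and $p_\pi(y^M|x^N)=p_\pi(x^N,y^M)/p_\pi(x^N)$ is the Bayesian predictive density, where $p(x^N,y^M|\theta)=p(x^N|\theta)p(y^M|\theta)$. The CNML3 predictive density is $q_{\mathrm{CNML3}}(y^M|x^N)=\dfrac{p(y^M|\hat\theta(x^N,y^M))}{\int_{X^M}p(z^M|\hat\theta(x^N,z^M))\,d\mu(z^M)}$. For a predictive density $q(y^M|x^N)$, $D^{N,M}_{K,q}(\pi)=\int_{X^N\times X^M}p_\pi(x^N,y^M)\log\frac{p_\pi(x^N,y^M)}{q(y^M|x^N)p_\pi(x^N)}\,d\mu(x^N,y^M)$. The KL risk is $R^{N,M}_{\mathrm{KL}}(\theta,q)=\int_{X^N}p(x^N|\theta)\int_{X^M}p(y^M|\theta)\log\frac{p(y^M|\theta)}{q(y^M|x^N)}\,d\mu(y^M)\,d\mu(x^N)$ and $R^{N,M}_{\mathrm{KL}}(\pi,p_\pi)=\int_\Theta R^{N,M}_{\mathrm{KL}}(\theta,p_\pi)\,d\pi(\theta)$ (the conditional mutual information). $|\cdot|$ is the Euclidean norm. *)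

theory Defs
  imports "HOL-Probability.Probability"
begin

definition sample :: "'x measure \<Rightarrow> nat \<Rightarrow> (nat \<Rightarrow> 'x) measure" where
  "sample \<mu> k = PiM {..<k} (\<lambda>_. \<mu>)"

definition lik :: "('a \<Rightarrow> 'x \<Rightarrow> real) \<Rightarrow> nat \<Rightarrow> 'a \<Rightarrow> (nat \<Rightarrow> 'x) \<Rightarrow> real" where
  "lik p k \<theta> z = (\<Prod>i<k. p \<theta> (z i))"

definition concat :: "nat \<Rightarrow> nat \<Rightarrow> (nat \<Rightarrow> 'x) \<Rightarrow> (nat \<Rightarrow> 'x) \<Rightarrow> (nat \<Rightarrow> 'x)" where
  "concat N M x y = (\<lambda>i\<in>{..<N+M}. if i < N then x i else y (i - N))"

definition single :: "'x \<Rightarrow> (nat \<Rightarrow> 'x)" where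
  "single z = (\<lambda>i\<in>{..<1::nat}. z)"

text \<open>P_K: Borel probability measures on Theta supported in K, realised as Borel
  probability measures on (the subspace) K.\<close>
definition priors :: "'a::topological_space set \<Rightarrow> 'a measure set" where
  "priors K = {\<pi>. prob_space \<pi> \<and> sets \<pi> = sets (restrict_space borel K)}"

definition mix :: "'a measure \<Rightarrow> ('a \<Rightarrow> 'x \<Rightarrow> real) \<Rightarrow> nat \<Rightarrow> (nat \<Rightarrow> 'x) \<Rightarrow> real" where
  "mix \<pi> p k z = (\<integral>\<theta>. lik p k \<theta> z \<partial>\<pi>)"

definition mix2 :: "'a measure \<Rightarrow> ('a \<Rightarrow> 'x \<Rightarrow> real) \<Rightarrow> nat \<Rightarrow> nat
    \<Rightarrow> (nat \<Rightarrow> 'x) \<Rightarrow> (nat \<Rightarrow> 'x) \<Rightarrow> real" where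
  "mix2 \<pi> p N M x y = (\<integral>\<theta>. lik p N \<theta> x * lik p M \<theta> y \<partial>\<pi>)"

definition bayes_pred :: "'a measure \<Rightarrow> ('a \<Rightarrow> 'x \<Rightarrow> real) \<Rightarrow> nat \<Rightarrow> nat
    \<Rightarrow> (nat \<Rightarrow> 'x) \<Rightarrow> (nat \<Rightarrow> 'x) \<Rightarrow> real" where
  "bayes_pred \<pi> p N M x y = mix2 \<pi> p N M x y / mix \<pi> p N x"

definition cnml3_norm :: "'x measure \<Rightarrow> ('a \<Rightarrow> 'x \<Rightarrow> real) \<Rightarrow> (nat \<Rightarrow> (nat \<Rightarrow> 'x) \<Rightarrow> 'a)
    \<Rightarrow> nat \<Rightarrow> nat \<Rightarrow> (nat \<Rightarrow> 'x) \<Rightarrow> ennreal" where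
  "cnml3_norm \<mu> p mle N M x =
     (\<integral>\<^sup>+ z. ennreal (lik p M (mle (N + M) (concat N M x z)) z) \<partial>sample \<mu> M)"

definition q_cnml3 :: "'x measure \<Rightarrow> ('a \<Rightarrow> 'x \<Rightarrow> real) \<Rightarrow> (nat \<Rightarrow> (nat \<Rightarrow> 'x) \<Rightarrow> 'a)
    \<Rightarrow> nat \<Rightarrow> nat \<Rightarrow> (nat \<Rightarrow> 'x) \<Rightarrow> (nat \<Rightarrow> 'x) \<Rightarrow> real" where
  "q_cnml3 \<mu> p mle N M x y =
     lik p M (mle (N + M) (concat N M x y)) y / enn2real (cnml3_norm \<mu> p mle N M x)"

definition Dq :: "'x measure \<Rightarrow> ('a \<Rightarrow> 'x \<Rightarrow> real) \<Rightarrow> 'a measure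
    \<Rightarrow> ((nat \<Rightarrow> 'x) \<Rightarrow> (nat \<Rightarrow> 'x) \<Rightarrow> real) \<Rightarrow> nat \<Rightarrow> nat \<Rightarrow> real" where
  "Dq \<mu> p \<pi> q N M =
     (\<integral>xy. mix2 \<pi> p N M (fst xy) (snd xy)
            * ln (mix2 \<pi> p N M (fst xy) (snd xy) / (q (fst xy) (snd xy) * mix \<pi> p N (fst xy)))
        \<partial>(sample \<mu> N \<Otimes>\<^sub>M sample \<mu> M))"

definition Dq_integrand :: "('a \<Rightarrow> 'x \<Rightarrow> real) \<Rightarrow> 'a measure
    \<Rightarrow> ((nat \<Rightarrow> 'x) \<Rightarrow> (nat \<Rightarrow> 'x) \<Rightarrow> real) \<Rightarrow> nat \<Rightarrow> nat \<Rightarrow> (nat \<Rightarrow> 'x) \<times> (nat \<Rightarrow> 'x) \<Rightarrow> real" where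
  "Dq_integrand p \<pi> q N M xy =
     mix2 \<pi> p N M (fst xy) (snd xy)
       * ln (mix2 \<pi> p N M (fst xy) (snd xy) / (q (fst xy) (snd xy) * mix \<pi> p N (fst xy)))"

definition KL_risk :: "'x measure \<Rightarrow> ('a \<Rightarrow> 'x \<Rightarrow> real)
    \<Rightarrow> ((nat \<Rightarrow> 'x) \<Rightarrow> (nat \<Rightarrow> 'x) \<Rightarrow> real) \<Rightarrow> nat \<Rightarrow> nat \<Rightarrow> 'a \<Rightarrow> real" where
  "KL_risk \<mu> p q N M \<theta> =
     (\<integral>x. lik p N \<theta> x * (\<integral>y. lik p M \<theta> y * ln (lik p M \<theta> y / q x y) \<partial>sample \<mu> M)
        \<partial>sample \<mu> N)"

definition KL_risk_bayes :: "'x measure \<Rightarrow> ('a \<Rightarrow> 'x \<Rightarrow> real) \<Rightarrow> 'a measure \<Rightarrow> nat \<Rightarrow> nat \<Rightarrow> real" where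
  "KL_risk_bayes \<mu> p \<pi> N M = (\<integral>\<theta>. KL_risk \<mu> p (bayes_pred \<pi> p N M) N M \<theta> \<partial>\<pi>)"

definition KL_bayes_integrand :: "('a \<Rightarrow> 'x \<Rightarrow> real) \<Rightarrow> 'a measure \<Rightarrow> nat \<Rightarrow> nat
    \<Rightarrow> 'a \<times> (nat \<Rightarrow> 'x) \<times> (nat \<Rightarrow> 'x) \<Rightarrow> real" where
  "KL_bayes_integrand p \<pi> N M t =
     (case t of (\<theta>, x, y) \<Rightarrow>
        lik p N \<theta> x * (lik p M \<theta> y * ln (lik p M \<theta> y / bayes_pred \<pi> p N M x y)))"

definition moment_bound :: "'x measure \<Rightarrow> ('a \<Rightarrow> 'x \<Rightarrow> real) \<Rightarrow> 'a set
    \<Rightarrow> ('x \<Rightarrow> real) \<Rightarrow> ereal \<Rightarrow> bool" where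
  "moment_bound \<mu> p K F a =
     (if a = \<infinity> then esssup \<mu> (\<lambda>z. ereal (F z)) < \<infinity>
      else (\<Squnion>\<theta>\<in>K. \<integral>\<^sup>+ z. ennreal (p \<theta> z * F z powr real_of_ereal a) \<partial>\<mu>) < \<infinity>)"

definition conj_exp :: "ereal \<Rightarrow> ereal" where
  "conj_exp a = (if a = \<infinity> then 1 else if a = 1 then \<infinity>
                 else ereal (real_of_ereal a / (real_of_ereal a - 1)))"

text \<open>Condition (A2): lim_k sup_{theta in K} E_theta |hat theta(z^k) - theta|^beta = 0;
  for beta = infinity the beta-th moment is read as the essential supremum.\<close>
definition A2_cond :: "'x measure \<Rightarrow> ('a::real_normed_vector \<Rightarrow> 'x \<Rightarrow> real) \<Rightarrow> 'a set
    \<Rightarrow> (nat \<Rightarrow> (nat \<Rightarrow> 'x) \<Rightarrow> 'a) \<Rightarrow> ereal \<Rightarrow> bool" where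
  "A2_cond \<mu> p K mle b =
     (if b = \<infinity> then
        ((\<lambda>k. \<Squnion>\<theta>\<in>K. esssup (density (sample \<mu> k) (\<lambda>z. ennreal (lik p k \<theta> z)))
                             (\<lambda>z. ennreal (norm (mle k z - \<theta>)))) \<longlonglongrightarrow> 0)
      else
        ((\<lambda>k. \<Squnion>\<theta>\<in>K. \<integral>\<^sup>+ z. ennreal (lik p k \<theta> z * norm (mle k z - \<theta>) powr real_of_ereal b)
                             \<partial>sample \<mu> k) \<longlonglongrightarrow> 0))"

end

theory Submission
  imports Defs
begin

text \<open>
  Write \<open>Z\<close> for the CNML3 normaliser. In the sum of the two risks the mixture densities cancel, so
  the sum is the \<open>\<pi>\<close>-average of \<open>E log Z(x) - E log (p(y|mle(x,y)) / p(y|\<theta>))\<close>, the expectations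
  being taken under \<open>\<theta>\<close>. Condition (A5) handles the first term, and the second one is squeezed
  towards \<open>d/2\<close>. From above, it grows when \<open>mle(x,y)\<close> is replaced by \<open>mle(y)\<close>, and (A4) applies to
  the sample \<open>y\<close>. From below, it equals the gain of the whole sample, to which (A4) applies, minus
  the gain of the \<open>N\<close> observations \<open>x\<close>. The gain of one observation is at most \<open>\<eta> L\<close> when the
  estimator is within \<open>\<eta>\<close> of \<open>\<theta>\<close> and at most \<open>T\<close> otherwise; \<open>L\<close> has bounded mean, \<open>T\<close> is uniformly
  integrable because \<open>r > 1\<close>, and (A2) makes the second event improbable.

  All integrability follows from \<open>p(z|\<theta>) \<le> exp(T(z)) p(z|\<theta>')\<close> for \<open>\<theta> \<in> \<Theta>\<close>, \<open>\<theta>' \<in> K\<close>: it bounds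
  every logarithm other than \<open>log Z\<close> by sums of \<open>T\<close>, and \<open>log Z\<close> from below, so that (A5) also
  controls \<open>|log Z|\<close>.
\<close>

section \<open>Samples and concatenation\<close>

lemma space_sample: "space (sample \<mu> k) = {..<k} \<rightarrow>\<^sub>E space \<mu>"
  by (simp add: sample_def space_PiM)

lemma sets_sample_cong: "sets \<mu> = sets \<nu> \<Longrightarrow> sets (sample \<mu> k) = sets (sample \<nu> k)"
  unfolding sample_def by (intro sets_PiM_cong) auto

lemma sample_component: "z \<in> space (sample \<mu> k) \<Longrightarrow> i < k \<Longrightarrow> z i \<in> space \<mu>"
  by (auto simp: space_sample)

lemma measurable_sample_component:
  "i < k \<Longrightarrow> (\<lambda>z. z i) \<in> measurable (sample \<mu> k) \<mu>"
  unfolding sample_def by (rule measurable_component_singleton) auto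

lemma sigma_finite_sample:
  assumes "sigma_finite_measure \<mu>"
  shows "sigma_finite_measure (sample \<mu> k)"
proof -
  interpret sigma_finite_measure \<mu> by fact
  interpret P: finite_product_sigma_finite "\<lambda>_. \<mu>" "{..<k}" by standard auto
  show ?thesis unfolding sample_def by (rule P.sigma_finite_measure_axioms)
qed

lemma prob_space_sample: "prob_space \<mu> \<Longrightarrow> prob_space (sample \<mu> k)"
  unfolding sample_def by (intro prob_space_PiM)

lemma distr_sample_component:
  "prob_space \<mu> \<Longrightarrow> i < k \<Longrightarrow> distr (sample \<mu> k) \<mu> (\<lambda>z. z i) = \<mu>"
  unfolding sample_def using distr_PiM_component[of "{..<k}" "\<lambda>_. \<mu>" i] by simp

text \<open>Both measures agree on measurable boxes, since the integral of a product of
  one-coordinate functions factorises. Sigma-finiteness of \<open>density \<mu> f\<close> makes the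
  measure with these values unique.\<close>

lemma density_sample_prod:
  assumes mu: "sigma_finite_measure \<mu>" and f[measurable]: "f \<in> borel_measurable \<mu>"
    and fin: "sigma_finite_measure (density \<mu> f)"
  shows "density (sample \<mu> k) (\<lambda>z. \<Prod>i<k. f (z i)) = sample (density \<mu> f) k"
proof -
  interpret sigma_finite_measure \<mu> by fact
  interpret M: product_sigma_finite "\<lambda>_::nat. \<mu>" by standard
  interpret D: sigma_finite_measure "density \<mu> f" by fact
  interpret DP: product_sigma_finite "\<lambda>_::nat. density \<mu> f" by standard
  have m[measurable]: "(\<lambda>z. \<Prod>i<k. f (z i)) \<in> borel_measurable (sample \<mu> k)"
    by (intro borel_measurable_prod_ennreal measurable_compose[OF measurable_sample_component f]) auto
  show ?thesis unfolding sample_def[of "density \<mu> f"]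
  proof (rule DP.PiM_eqI)
    show "sets (density (sample \<mu> k) (\<lambda>z. \<Prod>i<k. f (z i))) = sets (Pi\<^sub>M {..<k} (\<lambda>_. density \<mu> f))"
      using sets_sample_cong[of \<mu> "density \<mu> f" k] by (simp add: sample_def)
    fix A assume A: "\<And>i. i \<in> {..<k} \<Longrightarrow> A i \<in> sets (density \<mu> f)"
    then have A': "\<And>i. i < k \<Longrightarrow> A i \<in> sets \<mu>" by simp
    have PA: "Pi\<^sub>E {..<k} A \<in> sets (sample \<mu> k)"
      unfolding sample_def using A' by (intro sets_PiM_I_finite) auto
    have "emeasure (density (sample \<mu> k) (\<lambda>z. \<Prod>i<k. f (z i))) (Pi\<^sub>E {..<k} A)
        = (\<integral>\<^sup>+ z. (\<Prod>i<k. f (z i)) * indicator (Pi\<^sub>E {..<k} A) z \<partial>sample \<mu> k)"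
      by (rule emeasure_density[OF m PA])
    also have "\<dots> = (\<integral>\<^sup>+ z. (\<Prod>i<k. f (z i) * indicator (A i) (z i)) \<partial>sample \<mu> k)"
    proof (intro nn_integral_cong)
      fix z assume z: "z \<in> space (sample \<mu> k)"
      then have iff: "z \<in> Pi\<^sub>E {..<k} A \<longleftrightarrow> (\<forall>i<k. z i \<in> A i)"
        by (auto simp: space_sample PiE_def)
      then have "indicator (Pi\<^sub>E {..<k} A) z = (\<Prod>i<k. indicator (A i) (z i) :: ennreal)"
      proof (cases "\<forall>i<k. z i \<in> A i")
        case False
        \<comment> \<open>One vanishing indicator makes the whole product vanish.\<close>
        then obtain i where "i < k" "z i \<notin> A i" by auto
        then have "(\<Prod>i<k. indicator (A i) (z i) :: ennreal) = 0"
          by (intro prod_zero bexI[of _ i]) auto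
        then show ?thesis using iff False by (metis indicator_simps(2))
      qed (simp add: iff)
      then show "(\<Prod>i<k. f (z i)) * indicator (Pi\<^sub>E {..<k} A) z = (\<Prod>i<k. f (z i) * indicator (A i) (z i))"
        by (simp add: prod.distrib)
    qed
    also have "\<dots> = (\<Prod>i<k. \<integral>\<^sup>+ z. f z * indicator (A i) z \<partial>\<mu>)"
      unfolding sample_def using A' by (intro M.product_nn_integral_prod) auto
    also have "\<dots> = (\<Prod>i<k. emeasure (density \<mu> f) (A i))"
      using A' by (intro prod.cong refl) (simp add: emeasure_density)
    finally show "emeasure (density (sample \<mu> k) (\<lambda>z. \<Prod>i<k. f (z i))) (Pi\<^sub>E {..<k} A)
      = (\<Prod>i<k. emeasure (density \<mu> f) (A i))" .
  qed simp
qed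

lemma concat_in_space:
  "x \<in> space (sample \<mu> N) \<Longrightarrow> y \<in> space (sample \<mu> M) \<Longrightarrow> concat N M x y \<in> space (sample \<mu> (N + M))"
  by (auto simp: space_sample concat_def PiE_iff)

lemma measurable_concat [measurable]:
  "(\<lambda>(x, y). concat N M x y) \<in> measurable (sample \<mu> N \<Otimes>\<^sub>M sample \<mu> M) (sample \<mu> (N + M))"
  unfolding concat_def split_def sample_def[of \<mu> "N + M"]
proof (rule measurable_restrict)
  fix i assume i: "i \<in> {..<N+M}"
  show "(\<lambda>xy. if i < N then fst xy i else snd xy (i - N)) \<in> measurable (sample \<mu> N \<Otimes>\<^sub>M sample \<mu> M) \<mu>"
  proof (cases "i < N")
    case True
    then show ?thesis using measurable_compose[OF measurable_fst measurable_sample_component] by simp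
  next
    case False
    then have "i - N < M" using i by auto
    then show ?thesis using False measurable_compose[OF measurable_snd measurable_sample_component] by simp
  qed
qed

lemma prod_lessThan_add: "(\<Prod>i<N + M. f i) = (\<Prod>i<N. f i) * (\<Prod>j<M. f (N + j))"
  for f :: "nat \<Rightarrow> 'a::comm_monoid_mult"
  by (induction M) (auto simp: mult.assoc)

text \<open>The preimage of a box under concatenation is a product of two boxes, so both measures
  take the same values on boxes. Used below for the law of an observation rather than for the base
  measure.\<close>

lemma distr_concat_sample:
  assumes mu: "sigma_finite_measure \<mu>"
  shows "distr (sample \<mu> N \<Otimes>\<^sub>M sample \<mu> M) (sample \<mu> (N + M)) (\<lambda>(x, y). concat N M x y) = sample \<mu> (N + M)"
proof -
  interpret sigma_finite_measure \<mu> by fact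
  interpret M: product_sigma_finite "\<lambda>_::nat. \<mu>" by standard
  interpret sM: sigma_finite_measure "sample \<mu> M" by (rule sigma_finite_sample) fact
  show ?thesis unfolding sample_def[of \<mu> "N + M"]
  proof (rule M.PiM_eqI)
    fix A assume A: "\<And>i. i \<in> {..<N + M} \<Longrightarrow> A i \<in> sets \<mu>"
    have PA: "Pi\<^sub>E {..<N} A \<in> sets (sample \<mu> N)" "Pi\<^sub>E {..<M} (\<lambda>j. A (N + j)) \<in> sets (sample \<mu> M)"
        "Pi\<^sub>E {..<N+M} A \<in> sets (sample \<mu> (N + M))"
      unfolding sample_def using A by (auto intro!: sets_PiM_I_finite)
    have "(\<lambda>(x, y). concat N M x y) -` Pi\<^sub>E {..<N + M} A \<inter> space (sample \<mu> N \<Otimes>\<^sub>M sample \<mu> M)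
        = Pi\<^sub>E {..<N} A \<times> Pi\<^sub>E {..<M} (\<lambda>j. A (N + j))" (is "?V = ?B")
    proof (intro set_eqI iffI; clarify)
      fix x y assume "(x, y) \<in> space (sample \<mu> N \<Otimes>\<^sub>M sample \<mu> M)" and c: "concat N M x y \<in> Pi\<^sub>E {..<N + M} A"
      then have e: "x \<in> extensional {..<N}" "y \<in> extensional {..<M}"
        by (auto simp: space_pair_measure space_sample PiE_def)
      have c': "concat N M x y i \<in> A i" if "i < N + M" for i using c that by auto
      have "x i \<in> A i" if "i < N" for i using c'[of i] that by (simp add: concat_def)
      moreover have "y i \<in> A (N + i)" if "i < M" for i using c'[of "N + i"] that by (simp add: concat_def)
      ultimately show "x \<in> Pi\<^sub>E {..<N} A \<and> y \<in> Pi\<^sub>E {..<M} (\<lambda>j. A (N + j))" using e by (auto simp: PiE_def)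
    next
      fix x y assume xy: "x \<in> Pi\<^sub>E {..<N} A" "y \<in> Pi\<^sub>E {..<M} (\<lambda>j. A (N + j))"
      have "(if i < N then x i else y (i - N)) \<in> A i" if "i < N + M" for i
      proof (cases "i < N")
        case False
        then have "y (i - N) \<in> A (N + (i - N))" using xy(2) that by (intro PiE_mem[OF xy(2)]) auto
        then show ?thesis using False by simp
      qed (use xy in auto)
      then have "concat N M x y \<in> Pi\<^sub>E {..<N + M} A"
        by (auto simp: concat_def)
      moreover have "x \<in> space (sample \<mu> N)" "y \<in> space (sample \<mu> M)"
        using xy PA[THEN sets.sets_into_space] by auto
      ultimately show "(x, y) \<in> ?V" by (auto simp: space_pair_measure)
    qed
    then have "emeasure (distr (sample \<mu> N \<Otimes>\<^sub>M sample \<mu> M) (sample \<mu> (N + M)) (\<lambda>(x, y). concat N M x y)) (Pi\<^sub>E {..<N + M} A)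
      = emeasure (sample \<mu> N \<Otimes>\<^sub>M sample \<mu> M) ?B"
      using PA by (subst emeasure_distr) auto
    also have "\<dots> = emeasure (sample \<mu> N) (Pi\<^sub>E {..<N} A) * emeasure (sample \<mu> M) (Pi\<^sub>E {..<M} (\<lambda>j. A (N + j)))"
      using PA by (intro sM.emeasure_pair_measure_Times)
    also have "\<dots> = (\<Prod>i<N. emeasure \<mu> (A i)) * (\<Prod>j<M. emeasure \<mu> (A (N + j)))"
      unfolding sample_def using A by (subst (1 2) M.emeasure_PiM) auto
    also have "\<dots> = (\<Prod>i<N + M. emeasure \<mu> (A i))" by (simp add: prod_lessThan_add)
    finally show "emeasure (distr (sample \<mu> N \<Otimes>\<^sub>M sample \<mu> M) (Pi\<^sub>M {..<N+M} (\<lambda>_. \<mu>)) (\<lambda>(x, y). concat N M x y)) (Pi\<^sub>E {..<N + M} A)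
      = (\<Prod>i<N + M. emeasure \<mu> (A i))" by (simp add: sample_def)
  qed simp_all
qed

lemma lik_concat: "lik p (N + M) \<theta> (concat N M x y) = lik p N \<theta> x * lik p M \<theta> y"
  unfolding lik_def prod_lessThan_add by (simp add: concat_def)

lemma lik_1_single: "lik p 1 \<theta> (single z) = p \<theta> z"
  by (simp add: lik_def single_def)

lemma single_in_space: "z \<in> space \<mu> \<Longrightarrow> single z \<in> space (sample \<mu> 1)"
  by (auto simp: space_sample single_def)

lemma distr_pair_snd:
  assumes "prob_space M1" "sigma_finite_measure M2"
  shows "distr (M1 \<Otimes>\<^sub>M M2) M2 snd = M2"
proof (rule measure_eqI)
  interpret M1: prob_space M1 by fact
  interpret M2: sigma_finite_measure M2 by fact
  fix A assume "A \<in> sets (distr (M1 \<Otimes>\<^sub>M M2) M2 snd)"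
  then have A: "A \<in> sets M2" by simp
  then have "snd -` A \<inter> space (M1 \<Otimes>\<^sub>M M2) = space M1 \<times> A"
    using sets.sets_into_space[OF A] by (auto simp: space_pair_measure)
  then show "emeasure (distr (M1 \<Otimes>\<^sub>M M2) M2 snd) A = emeasure M2 A"
    using A by (simp add: emeasure_distr M2.emeasure_pair_measure_Times M1.emeasure_space_1)
qed simp

lemma integrable_le_of_nn_integral_le:
  fixes f :: "'b \<Rightarrow> real"
  assumes f: "f \<in> borel_measurable M" and nn: "\<And>x. x \<in> space M \<Longrightarrow> 0 \<le> f x"
    and le: "(\<integral>\<^sup>+ x. ennreal (f x) \<partial>M) \<le> ennreal b" and b: "0 \<le> b"
  shows "integrable M f" "(\<integral>x. f x \<partial>M) \<le> b"
proof -
  show int: "integrable M f"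
    using f nn le by (intro integrableI_nonneg AE_I2) (auto simp: le_less_trans)
  then have "ennreal (\<integral>x. f x \<partial>M) \<le> ennreal b"
    using le nn by (subst nn_integral_eq_integral[symmetric]) auto
  then show "(\<integral>x. f x \<partial>M) \<le> b" using b by simp
qed

section \<open>Envelope bounds for the likelihood\<close>

text \<open>Collects the non-asymptotic hypotheses. Of (A3) only the pointwise bound enters here;
  the moment bounds and the asymptotic conditions are supplied to the individual lemmas that rest on
  them.\<close>

locale mle_model =
  fixes \<mu> :: "'x measure"
    and p :: "'a::euclidean_space \<Rightarrow> 'x \<Rightarrow> real"
    and \<Theta> K :: "'a set"
    and mle :: "nat \<Rightarrow> (nat \<Rightarrow> 'x) \<Rightarrow> 'a"
    and T :: "'x \<Rightarrow> real"
  assumes sigma_fin: "sigma_finite_measure \<mu>"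
    and p_meas: "(\<lambda>(\<theta>, z). p \<theta> z) \<in> borel_measurable (restrict_space borel \<Theta> \<Otimes>\<^sub>M \<mu>)"
    and p_nonneg: "\<And>\<theta> z. \<theta> \<in> \<Theta> \<Longrightarrow> z \<in> space \<mu> \<Longrightarrow> 0 \<le> p \<theta> z"
    and p_prob: "\<And>\<theta>. \<theta> \<in> \<Theta> \<Longrightarrow> (\<integral>\<^sup>+ z. ennreal (p \<theta> z) \<partial>\<mu>) = 1"
    and mle_meas: "\<And>k. k \<ge> 1 \<Longrightarrow> mle k \<in> borel_measurable (sample \<mu> k)"
    and mle_in: "\<And>k z. k \<ge> 1 \<Longrightarrow> z \<in> space (sample \<mu> k) \<Longrightarrow> mle k z \<in> \<Theta>"
    and mle_max: "\<And>k z \<theta>. k \<ge> 1 \<Longrightarrow> z \<in> space (sample \<mu> k) \<Longrightarrow> \<theta> \<in> \<Theta> \<Longrightarrow>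
                    lik p k \<theta> z \<le> lik p k (mle k z) z"
    and K_subset: "K \<subseteq> \<Theta>"
    and p_pos: "\<And>\<theta> z. \<theta> \<in> K \<Longrightarrow> z \<in> space \<mu> \<Longrightarrow> 0 < p \<theta> z"
    and T_meas: "T \<in> borel_measurable \<mu>"
    and T_nonneg: "\<And>z. z \<in> space \<mu> \<Longrightarrow> 0 \<le> T z"
    and T_bound: "\<And>z \<theta>. z \<in> space \<mu> \<Longrightarrow> \<theta> \<in> K \<Longrightarrow>
        ln (p (mle 1 (single z)) z) - ln (p \<theta> z) \<le> T z"
begin

text \<open>The law of one observation under \<theta>. It turns integrals weighted by a likelihood
  into expectations over probability spaces, where marginals and independence are available.\<close>

definition obs :: "'a \<Rightarrow> 'x measure" where
  "obs \<theta> = density \<mu> (\<lambda>z. ennreal (p \<theta> z))"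

text \<open>Logarithm of the envelope for a sample of size k: likelihood ratios against a parameter
  of K are at most \<open>exp (Tsum k z)\<close>.\<close>

definition Tsum :: "nat \<Rightarrow> (nat \<Rightarrow> 'x) \<Rightarrow> real" where
  "Tsum k z = (\<Sum>i<k. T (z i))"

abbreviation cmle :: "nat \<Rightarrow> nat \<Rightarrow> (nat \<Rightarrow> 'x) \<Rightarrow> (nat \<Rightarrow> 'x) \<Rightarrow> 'a" where
  "cmle N M x y \<equiv> mle (N + M) (concat N M x y)"

lemma p_measurable: "\<theta> \<in> \<Theta> \<Longrightarrow> p \<theta> \<in> borel_measurable \<mu>"
  using measurable_compose[OF measurable_Pair1' p_meas, of \<theta>] by (simp add: space_restrict_space)

lemma sets_obs: "sets (obs \<theta>) = sets \<mu>" and space_obs: "space (obs \<theta>) = space \<mu>"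
  by (simp_all add: obs_def)

lemma prob_obs: "\<theta> \<in> \<Theta> \<Longrightarrow> prob_space (obs \<theta>)"
  unfolding obs_def using p_measurable[of \<theta>] p_prob[of \<theta>]
  by (intro prob_spaceI) (simp add: emeasure_density cong: nn_integral_cong)

lemma sets_sample_obs: "sets (sample (obs \<theta>) k) = sets (sample \<mu> k)"
  by (rule sets_sample_cong) (rule sets_obs)

lemma space_sample_obs: "space (sample (obs \<theta>) k) = space (sample \<mu> k)"
  by (rule sets_eq_imp_space_eq) (rule sets_sample_obs)

lemma lik_nonneg: "\<theta> \<in> \<Theta> \<Longrightarrow> z \<in> space (sample \<mu> k) \<Longrightarrow> 0 \<le> lik p k \<theta> z"
  unfolding lik_def by (intro prod_nonneg p_nonneg) (auto dest: sample_component)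

lemma lik_pos: "\<theta> \<in> K \<Longrightarrow> z \<in> space (sample \<mu> k) \<Longrightarrow> 0 < lik p k \<theta> z"
  unfolding lik_def by (intro prod_pos p_pos) (auto dest: sample_component)

text \<open>The parameter may vary with the point, because the likelihood is evaluated at estimators
  and integrated over priors; this is where joint measurability of \<open>p\<close> enters.\<close>

lemma lik_measurable_comp:
  assumes f: "f \<in> measurable R (restrict_space borel \<Theta>)" and g: "g \<in> measurable R (sample \<mu> k)"
  shows "(\<lambda>x. lik p k (f x) (g x)) \<in> borel_measurable R"
  unfolding lik_def
proof (rule borel_measurable_prod)
  fix i assume "i \<in> {..<k}"
  then have "(\<lambda>x. g x i) \<in> measurable R \<mu>"
    by (intro measurable_compose[OF g measurable_sample_component]) auto
  from measurable_compose[OF measurable_Pair[OF f this] p_meas]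
  show "(\<lambda>x. p (f x) (g x i)) \<in> borel_measurable R" by simp
qed

lemma lik_measurable: "\<theta> \<in> \<Theta> \<Longrightarrow> lik p k \<theta> \<in> borel_measurable (sample \<mu> k)"
  by (rule lik_measurable_comp) (auto simp: space_restrict_space)

lemma density_lik:
  assumes th: "\<theta> \<in> \<Theta>"
  shows "density (sample \<mu> k) (\<lambda>z. ennreal (lik p k \<theta> z)) = sample (obs \<theta>) k"
proof -
  interpret Q: prob_space "obs \<theta>" by (rule prob_obs) fact
  have "density (sample \<mu> k) (\<lambda>z. ennreal (lik p k \<theta> z))
      = density (sample \<mu> k) (\<lambda>z. \<Prod>i<k. ennreal (p \<theta> (z i)))"
  proof (rule density_cong)
    show "(\<lambda>z. ennreal (lik p k \<theta> z)) \<in> borel_measurable (sample \<mu> k)"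
      using lik_measurable[OF th] by simp
    show "(\<lambda>z. \<Prod>i<k. ennreal (p \<theta> (z i))) \<in> borel_measurable (sample \<mu> k)"
      by (intro borel_measurable_prod_ennreal measurable_compose[OF measurable_sample_component]
          measurable_compose[OF p_measurable[OF th]]) auto
    show "AE z in sample \<mu> k. ennreal (lik p k \<theta> z) = (\<Prod>i<k. ennreal (p \<theta> (z i)))"
      unfolding lik_def using th
      by (intro AE_I2 prod_ennreal[symmetric] p_nonneg) (auto dest: sample_component)
  qed
  also have "\<dots> = sample (obs \<theta>) k"
    unfolding obs_def using sigma_fin p_measurable[OF th] Q.sigma_finite_measure_axioms
    by (intro density_sample_prod) (auto simp: obs_def)
  finally show ?thesis .
qed

lemma mle_measurable: "k \<ge> 1 \<Longrightarrow> mle k \<in> measurable (sample \<mu> k) (restrict_space borel \<Theta>)"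
  using mle_meas mle_in by (intro measurable_restrict_space2) auto

lemma cmle_measurable:
  "N + M \<ge> 1 \<Longrightarrow> (\<lambda>(x, y). cmle N M x y) \<in> measurable (sample \<mu> N \<Otimes>\<^sub>M sample \<mu> M) (restrict_space borel \<Theta>)"
  using measurable_compose[OF measurable_concat mle_measurable, of N M] by (simp add: split_def)

lemma Tsum_nonneg: "z \<in> space (sample \<mu> k) \<Longrightarrow> 0 \<le> Tsum k z"
  unfolding Tsum_def by (intro sum_nonneg T_nonneg) (auto dest: sample_component)

lemma Tsum_measurable [measurable]: "Tsum k \<in> borel_measurable (sample \<mu> k)"
  unfolding Tsum_def
  by (intro borel_measurable_sum measurable_compose[OF measurable_sample_component T_meas]) auto

text \<open>The one-observation MLE dominates every parameter of \<Theta>, and (A3) compares it with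
  \<theta>'. Allowing \<theta> to range over all of \<Theta> matters because an MLE may leave
  K.\<close>

lemma p_le:
  assumes "\<theta> \<in> \<Theta>" "\<theta>' \<in> K" "z \<in> space \<mu>"
  shows "p \<theta> z \<le> exp (T z) * p \<theta>' z"
proof -
  let ?m = "mle 1 (single z)"
  have le: "p \<theta> z \<le> p ?m z" if "\<theta> \<in> \<Theta>" for \<theta>
    using mle_max[OF order_refl single_in_space[OF assms(3)] that] unfolding lik_1_single .
  have pos: "0 < p \<theta>' z" using p_pos assms by auto
  then have pos': "0 < p ?m z" using le[of \<theta>'] K_subset assms by auto
  have "ln (p ?m z) \<le> ln (exp (T z) * p \<theta>' z)"
    using T_bound[OF assms(3,2)] pos by (simp add: ln_mult)
  then have "p ?m z \<le> exp (T z) * p \<theta>' z"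
    using pos pos' by (subst (asm) ln_le_cancel_iff) auto
  then show ?thesis using le[OF assms(1)] by linarith
qed

lemma lik_le:
  assumes "\<theta> \<in> \<Theta>" "\<theta>' \<in> K" "z \<in> space (sample \<mu> k)"
  shows "lik p k \<theta> z \<le> exp (Tsum k z) * lik p k \<theta>' z"
proof -
  have "lik p k \<theta> z \<le> (\<Prod>i<k. exp (T (z i)) * p \<theta>' (z i))"
    unfolding lik_def using assms
    by (intro prod_mono conjI p_nonneg p_le) (auto dest: sample_component)
  also have "\<dots> = exp (Tsum k z) * lik p k \<theta>' z"
    by (simp add: prod.distrib lik_def Tsum_def exp_sum)
  finally show ?thesis .
qed

context
  fixes N M x y \<theta>
  assumes NM: "N + M \<ge> 1" and th: "\<theta> \<in> K"
    and x: "x \<in> space (sample \<mu> N)" and y: "y \<in> space (sample \<mu> M)"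
begin

lemma cmle_in: "cmle N M x y \<in> \<Theta>"
  by (intro mle_in concat_in_space NM x y)

lemma lik_cmle_ge: "lik p N \<theta> x * lik p M \<theta> y \<le> lik p N (cmle N M x y) x * lik p M (cmle N M x y) y"
  using mle_max[OF NM concat_in_space[OF x y], of \<theta>] K_subset th by (auto simp: lik_concat)

text \<open>The estimator may lie outside K, where positivity of the density is not assumed. Its
  joint likelihood dominates a positive one, so neither of the two nonnegative factors can
  vanish.\<close>

lemma lik_cmle_pos: "0 < lik p N (cmle N M x y) x" "0 < lik p M (cmle N M x y) y"
proof -
  have "0 < lik p N \<theta> x * lik p M \<theta> y" using lik_pos th x y by simp
  also note lik_cmle_ge
  finally show "0 < lik p N (cmle N M x y) x" "0 < lik p M (cmle N M x y) y"
    using lik_nonneg[OF cmle_in x] lik_nonneg[OF cmle_in y] by (auto simp: zero_less_mult_iff)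
qed

text \<open>The joint MLE can lose likelihood on y only in exchange for a gain on x, and the gain on
  x is at most \<open>exp (Tsum N x)\<close>. The loss is thus bounded independently of M and
  y.\<close>

lemma lik_le_cmle: "lik p M \<theta> y \<le> exp (Tsum N x) * lik p M (cmle N M x y) y"
proof -
  have "lik p N \<theta> x * lik p M \<theta> y \<le> (exp (Tsum N x) * lik p N \<theta> x) * lik p M (cmle N M x y) y"
    using lik_cmle_ge mult_right_mono[OF lik_le[OF cmle_in th x], of "lik p M (cmle N M x y) y"] lik_cmle_pos
    by linarith
  then have "lik p N \<theta> x * lik p M \<theta> y \<le> lik p N \<theta> x * (exp (Tsum N x) * lik p M (cmle N M x y) y)"
    by (simp add: ac_simps)
  then show ?thesis using lik_pos[OF th x] by simp
qed

lemma ln_lik_cmle_bounds: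
  "ln (lik p M (cmle N M x y) y) - ln (lik p M \<theta> y) \<le> Tsum M y"
  "ln (lik p M (cmle N M x y) y) - ln (lik p M \<theta> y) \<ge> - Tsum N x"
proof -
  let ?v = "lik p M (cmle N M x y) y"
  have l: "0 < lik p M \<theta> y" by (rule lik_pos[OF th y])
  have "ln ?v \<le> ln (exp (Tsum M y) * lik p M \<theta> y)"
    using lik_cmle_pos lik_le[OF cmle_in th y] l by (subst ln_le_cancel_iff) auto
  then show "ln ?v - ln (lik p M \<theta> y) \<le> Tsum M y" using l by (simp add: ln_mult)
  have "ln (lik p M \<theta> y) \<le> ln (exp (Tsum N x) * ?v)"
    using lik_cmle_pos lik_le_cmle l by (subst ln_le_cancel_iff) auto
  then show "ln ?v - ln (lik p M \<theta> y) \<ge> - Tsum N x" using lik_cmle_pos by (simp add: ln_mult)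
qed

end

section \<open>Lower bounds for the CNML3 normaliser\<close>

lemma cnml3_norm_measurable:
  assumes "N + M \<ge> 1"
  shows "cnml3_norm \<mu> p mle N M \<in> borel_measurable (sample \<mu> N)"
proof -
  interpret M: sigma_finite_measure "sample \<mu> M" by (rule sigma_finite_sample[OF sigma_fin])
  have "(\<lambda>(x, y). ennreal (lik p M (cmle N M x y) y)) \<in> borel_measurable (sample \<mu> N \<Otimes>\<^sub>M sample \<mu> M)"
    using lik_measurable_comp[OF cmle_measurable[OF assms] measurable_snd]
    by (simp add: split_def)
  then show ?thesis unfolding cnml3_norm_def by (rule M.borel_measurable_nn_integral)
qed

lemma nn_integral_lik:
  assumes "\<theta> \<in> \<Theta>"
  shows "(\<integral>\<^sup>+ z. ennreal (lik p k \<theta> z) \<partial>sample \<mu> k) = 1"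
proof -
  interpret prob_space "density (sample \<mu> k) (\<lambda>z. ennreal (lik p k \<theta> z))"
    unfolding density_lik[OF assms] by (intro prob_space_sample prob_obs assms)
  show ?thesis using emeasure_space_1 lik_measurable[OF assms, of k]
    by (simp add: emeasure_density cong: nn_integral_cong)
qed

text \<open>Integrate \<open>lik_le_cmle\<close> over y: the likelihood at \<theta> has total mass
  1, so only the factor depending on x remains.\<close>

lemma cnml3_norm_ge:
  assumes "N + M \<ge> 1" "\<theta> \<in> K" "x \<in> space (sample \<mu> N)"
  shows "cnml3_norm \<mu> p mle N M x \<ge> ennreal (exp (- Tsum N x))"
proof -
  have "ennreal (exp (- Tsum N x)) = ennreal (exp (- Tsum N x)) * (\<integral>\<^sup>+ y. ennreal (lik p M \<theta> y) \<partial>sample \<mu> M)"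
    using nn_integral_lik assms K_subset by (simp add: subset_eq)
  also have "\<dots> = (\<integral>\<^sup>+ y. ennreal (exp (- Tsum N x)) * ennreal (lik p M \<theta> y) \<partial>sample \<mu> M)"
    using lik_measurable assms K_subset by (intro nn_integral_cmult[symmetric]) auto
  also have "\<dots> \<le> cnml3_norm \<mu> p mle N M x"
    unfolding cnml3_norm_def
  proof (intro nn_integral_mono)
    fix y assume y: "y \<in> space (sample \<mu> M)"
    have "exp (- Tsum N x) * lik p M \<theta> y \<le> lik p M (cmle N M x y) y"
      using lik_le_cmle[OF assms y] by (simp add: exp_minus field_simps)
    then show "ennreal (exp (- Tsum N x)) * ennreal (lik p M \<theta> y) \<le> ennreal (lik p M (cmle N M x y) y)"
      using lik_pos[OF assms(2) y] by (simp add: ennreal_mult'[symmetric] ennreal_leI)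
  qed
  finally show ?thesis .
qed

text \<open>Finiteness is essential for the real-valued form, since \<open>enn2real\<close> sends
  infinity to 0.\<close>

lemma ln_cnml3_norm_ge:
  assumes "N + M \<ge> 1" "\<theta> \<in> K" "x \<in> space (sample \<mu> N)" "cnml3_norm \<mu> p mle N M x < \<infinity>"
  shows "0 < enn2real (cnml3_norm \<mu> p mle N M x)"
    and "ln (enn2real (cnml3_norm \<mu> p mle N M x)) \<ge> - Tsum N x"
proof -
  have le: "exp (- Tsum N x) \<le> enn2real (cnml3_norm \<mu> p mle N M x)"
    using enn2real_mono[OF cnml3_norm_ge[OF assms(1-3)]] assms(4) by simp
  then show pos: "0 < enn2real (cnml3_norm \<mu> p mle N M x)" by (rule less_le_trans[OF exp_gt_zero])
  show "ln (enn2real (cnml3_norm \<mu> p mle N M x)) \<ge> - Tsum N x"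
    using le pos by (metis ln_exp ln_le_cancel_iff exp_gt_zero)
qed

subsection \<open>Expectations under a parameter\<close>

abbreviation pair_lik :: "nat \<Rightarrow> nat \<Rightarrow> 'a \<Rightarrow> (nat \<Rightarrow> 'x) \<times> (nat \<Rightarrow> 'x) \<Rightarrow> real" where
  "pair_lik N M \<theta> xy \<equiv> lik p N \<theta> (fst xy) * lik p M \<theta> (snd xy)"

abbreviation pair_sample :: "nat \<Rightarrow> nat \<Rightarrow> ((nat \<Rightarrow> 'x) \<times> (nat \<Rightarrow> 'x)) measure" where
  "pair_sample N M \<equiv> sample \<mu> N \<Otimes>\<^sub>M sample \<mu> M"

abbreviation pair_obs :: "nat \<Rightarrow> nat \<Rightarrow> 'a \<Rightarrow> ((nat \<Rightarrow> 'x) \<times> (nat \<Rightarrow> 'x)) measure" where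
  "pair_obs N M \<theta> \<equiv> sample (obs \<theta>) N \<Otimes>\<^sub>M sample (obs \<theta>) M"

lemma sets_pair_obs: "sets (pair_obs N M \<theta>) = sets (pair_sample N M)"
  by (intro sets_pair_measure_cong sets_sample_obs)

lemma space_pair_obs: "space (pair_obs N M \<theta>) = space (pair_sample N M)"
  by (rule sets_eq_imp_space_eq) (rule sets_pair_obs)

lemma sigma_finite_pair_sample: "sigma_finite_measure (pair_sample N M)"
proof -
  interpret N: sigma_finite_measure "sample \<mu> N" by (rule sigma_finite_sample[OF sigma_fin])
  interpret M: sigma_finite_measure "sample \<mu> M" by (rule sigma_finite_sample[OF sigma_fin])
  interpret P: pair_sigma_finite "sample \<mu> N" "sample \<mu> M" ..
  show ?thesis by (rule P.sigma_finite_measure_axioms)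
qed

lemma pair_lik_nonneg: "\<theta> \<in> \<Theta> \<Longrightarrow> xy \<in> space (pair_sample N M) \<Longrightarrow> 0 \<le> pair_lik N M \<theta> xy"
  by (auto simp: space_pair_measure lik_nonneg)

lemma pair_lik_measurable:
  "\<theta> \<in> \<Theta> \<Longrightarrow> pair_lik N M \<theta> \<in> borel_measurable (pair_sample N M)"
  by (intro borel_measurable_times measurable_compose[OF measurable_fst lik_measurable]
      measurable_compose[OF measurable_snd lik_measurable])

lemma density_pair_lik:
  assumes th: "\<theta> \<in> \<Theta>"
  shows "density (pair_sample N M) (\<lambda>xy. ennreal (pair_lik N M \<theta> xy)) = pair_obs N M \<theta>"
proof -
  interpret M: prob_space "sample (obs \<theta>) M" by (intro prob_space_sample prob_obs th)
  have "pair_obs N M \<theta> = density (pair_sample N M) (\<lambda>(x, y). ennreal (lik p N \<theta> x) * ennreal (lik p M \<theta> y))"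
    unfolding density_lik[OF th, symmetric]
    using lik_measurable[OF th] M.sigma_finite_measure_axioms
    by (intro pair_measure_density sigma_finite_sample sigma_fin) (auto simp: density_lik[OF th])
  also have "\<dots> = density (pair_sample N M) (\<lambda>xy. ennreal (pair_lik N M \<theta> xy))"
  proof (rule density_cong)
    have [measurable]: "lik p k \<theta> \<in> borel_measurable (sample \<mu> k)" for k
      by (rule lik_measurable[OF th])
    show "(\<lambda>(x, y). ennreal (lik p N \<theta> x) * ennreal (lik p M \<theta> y)) \<in> borel_measurable (pair_sample N M)"
      by measurable
    show "(\<lambda>xy. ennreal (pair_lik N M \<theta> xy)) \<in> borel_measurable (pair_sample N M)"
      by measurable
    show "AE xy in pair_sample N M. (case xy of (x, y) \<Rightarrow> ennreal (lik p N \<theta> x) * ennreal (lik p M \<theta> y))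
        = ennreal (pair_lik N M \<theta> xy)"
      using th by (intro AE_I2) (auto simp: space_pair_measure ennreal_mult lik_nonneg)
  qed
  finally show ?thesis ..
qed

text \<open>Translates the likelihood-weighted integrals in the definitions of the risks into
  expectations under \<theta>.\<close>

lemma
  fixes f :: "(nat \<Rightarrow> 'x) \<times> (nat \<Rightarrow> 'x) \<Rightarrow> real"
  assumes th: "\<theta> \<in> \<Theta>" and f: "f \<in> borel_measurable (pair_sample N M)"
  shows integrable_pair_lik: "integrable (pair_sample N M) (\<lambda>xy. pair_lik N M \<theta> xy * f xy) \<longleftrightarrow> integrable (pair_obs N M \<theta>) f"
    and integral_pair_lik: "(\<integral>xy. pair_lik N M \<theta> xy * f xy \<partial>pair_sample N M) = (\<integral>xy. f xy \<partial>pair_obs N M \<theta>)"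
  unfolding density_pair_lik[OF th, symmetric]
  using f pair_lik_measurable[OF th, of N M] pair_lik_nonneg[OF th, of _ N M]
  by (subst integrable_density integral_density; auto intro!: AE_I2)+

lemma
  fixes f :: "(nat \<Rightarrow> 'x) \<Rightarrow> real"
  assumes th: "\<theta> \<in> \<Theta>" and f: "f \<in> borel_measurable (sample \<mu> k)"
  shows integrable_lik: "integrable (sample \<mu> k) (\<lambda>z. lik p k \<theta> z * f z) \<longleftrightarrow> integrable (sample (obs \<theta>) k) f"
    and integral_lik: "(\<integral>z. lik p k \<theta> z * f z \<partial>sample \<mu> k) = (\<integral>z. f z \<partial>sample (obs \<theta>) k)"
  unfolding density_lik[OF th, symmetric]
  using f lik_measurable[OF th, of k] lik_nonneg[OF th, of _ k]
  by (subst integrable_density integral_density; auto intro!: AE_I2)+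

lemma
  fixes f :: "(nat \<Rightarrow> 'x) \<Rightarrow> real"
  assumes th: "\<theta> \<in> \<Theta>" and f: "f \<in> borel_measurable (sample \<mu> N)"
  shows integrable_pair_obs_fst: "integrable (pair_obs N M \<theta>) (\<lambda>xy. f (fst xy)) \<longleftrightarrow> integrable (sample (obs \<theta>) N) f"
    and integral_pair_obs_fst: "(\<integral>xy. f (fst xy) \<partial>pair_obs N M \<theta>) = (\<integral>x. f x \<partial>sample (obs \<theta>) N)"
proof -
  interpret M: prob_space "sample (obs \<theta>) M" by (intro prob_space_sample prob_obs th)
  have f': "f \<in> borel_measurable (sample (obs \<theta>) N)"
    using f by (simp add: measurable_cong_sets[OF sets_sample_obs refl])
  show "integrable (pair_obs N M \<theta>) (\<lambda>xy. f (fst xy)) \<longleftrightarrow> integrable (sample (obs \<theta>) N) f"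
    using integrable_distr_eq[OF measurable_fst[where ?M2.0 = "sample (obs \<theta>) M"] f'] by (simp add: M.distr_pair_fst)
  show "(\<integral>xy. f (fst xy) \<partial>pair_obs N M \<theta>) = (\<integral>x. f x \<partial>sample (obs \<theta>) N)"
    using integral_distr[OF measurable_fst[where ?M2.0 = "sample (obs \<theta>) M"] f'] by (simp add: M.distr_pair_fst)
qed

lemma
  fixes f :: "(nat \<Rightarrow> 'x) \<Rightarrow> real"
  assumes th: "\<theta> \<in> \<Theta>" and f: "f \<in> borel_measurable (sample \<mu> M)"
  shows integrable_pair_obs_snd: "integrable (pair_obs N M \<theta>) (\<lambda>xy. f (snd xy)) \<longleftrightarrow> integrable (sample (obs \<theta>) M) f"
    and integral_pair_obs_snd: "(\<integral>xy. f (snd xy) \<partial>pair_obs N M \<theta>) = (\<integral>x. f x \<partial>sample (obs \<theta>) M)"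
proof -
  interpret N: prob_space "sample (obs \<theta>) N" by (intro prob_space_sample prob_obs th)
  interpret M: prob_space "sample (obs \<theta>) M" by (intro prob_space_sample prob_obs th)
  have d: "distr (pair_obs N M \<theta>) (sample (obs \<theta>) M) snd = sample (obs \<theta>) M"
    by (rule distr_pair_snd) unfold_locales
  have f': "f \<in> borel_measurable (sample (obs \<theta>) M)"
    using f by (simp add: measurable_cong_sets[OF sets_sample_obs refl])
  show "integrable (pair_obs N M \<theta>) (\<lambda>xy. f (snd xy)) \<longleftrightarrow> integrable (sample (obs \<theta>) M) f"
    using integrable_distr_eq[OF measurable_snd[where ?M1.0 = "sample (obs \<theta>) N"] f'] by (simp add: d)
  show "(\<integral>xy. f (snd xy) \<partial>pair_obs N M \<theta>) = (\<integral>x. f x \<partial>sample (obs \<theta>) M)"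
    using integral_distr[OF measurable_snd[where ?M1.0 = "sample (obs \<theta>) N"] f'] by (simp add: d)
qed

text \<open>Conditions (A2) and (A4) speak of one sample of size N + M; this transfers them to the
  pair (x, y).\<close>

lemma
  fixes f :: "(nat \<Rightarrow> 'x) \<Rightarrow> real"
  assumes th: "\<theta> \<in> \<Theta>" and f: "f \<in> borel_measurable (sample \<mu> (N + M))"
  shows integrable_pair_obs_concat: "integrable (pair_obs N M \<theta>) (\<lambda>(x, y). f (concat N M x y)) \<longleftrightarrow> integrable (sample (obs \<theta>) (N + M)) f"
    and integral_pair_obs_concat: "(\<integral>(x, y). f (concat N M x y) \<partial>pair_obs N M \<theta>) = (\<integral>z. f z \<partial>sample (obs \<theta>) (N + M))"
proof -
  interpret prob_space "obs \<theta>" by (intro prob_obs th)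
  note d = distr_concat_sample[OF sigma_finite_measure_axioms, of N M]
  have f': "f \<in> borel_measurable (sample (obs \<theta>) (N + M))"
    using f by (simp add: measurable_cong_sets[OF sets_sample_obs refl])
  show "integrable (pair_obs N M \<theta>) (\<lambda>(x, y). f (concat N M x y)) \<longleftrightarrow> integrable (sample (obs \<theta>) (N + M)) f"
    using integrable_distr_eq[OF measurable_concat f'] by (simp add: d[unfolded split_def] split_def)
  show "(\<integral>(x, y). f (concat N M x y) \<partial>pair_obs N M \<theta>) = (\<integral>z. f z \<partial>sample (obs \<theta>) (N + M))"
    using integral_distr[OF measurable_concat f'] by (simp add: d[unfolded split_def] split_def)
qed

lemma
  fixes f :: "'x \<Rightarrow> real"
  assumes th: "\<theta> \<in> \<Theta>" and i: "i < k" and f: "f \<in> borel_measurable \<mu>"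
  shows integrable_obs_component: "integrable (sample (obs \<theta>) k) (\<lambda>z. f (z i)) \<longleftrightarrow> integrable (obs \<theta>) f"
    and integral_obs_component: "(\<integral>z. f (z i) \<partial>sample (obs \<theta>) k) = (\<integral>z. f z \<partial>obs \<theta>)"
proof -
  have f': "f \<in> borel_measurable (obs \<theta>)" using f by (simp add: obs_def)
  note d = distr_sample_component[OF prob_obs[OF th] i]
  show "integrable (sample (obs \<theta>) k) (\<lambda>z. f (z i)) \<longleftrightarrow> integrable (obs \<theta>) f"
    using integrable_distr_eq[OF measurable_sample_component[OF i] f'] by (simp add: d)
  show "(\<integral>z. f (z i) \<partial>sample (obs \<theta>) k) = (\<integral>z. f z \<partial>obs \<theta>)"
    using integral_distr[OF measurable_sample_component[OF i] f'] by (simp add: d)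
qed

lemma
  assumes th: "\<theta> \<in> \<Theta>" and T: "integrable (obs \<theta>) T"
  shows integrable_Tsum: "integrable (sample (obs \<theta>) k) (Tsum k)"
    and integral_Tsum: "(\<integral>z. Tsum k z \<partial>sample (obs \<theta>) k) = real k * (\<integral>z. T z \<partial>obs \<theta>)"
proof -
  have i: "integrable (sample (obs \<theta>) k) (\<lambda>z. T (z i))" if "i < k" for i
    using integrable_obs_component[OF th that T_meas] T by simp
  then show "integrable (sample (obs \<theta>) k) (Tsum k)"
    unfolding Tsum_def by (intro Bochner_Integration.integrable_sum) auto
  show "(\<integral>z. Tsum k z \<partial>sample (obs \<theta>) k) = real k * (\<integral>z. T z \<partial>obs \<theta>)"
    unfolding Tsum_def using i
    by (subst Bochner_Integration.integral_sum) (auto simp: integral_obs_component[OF th _ T_meas])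
qed

subsection \<open>Mixtures over a prior\<close>

context
  fixes \<pi> :: "'a measure"
  assumes prior: "\<pi> \<in> priors K"
begin

lemma prob_prior: "prob_space \<pi>"
  using prior by (simp add: priors_def)

lemma space_prior: "space \<pi> = K"
proof -
  have "sets \<pi> = sets (restrict_space borel K)" using prior by (simp add: priors_def)
  from sets_eq_imp_space_eq[OF this] show ?thesis by (simp add: space_restrict_space)
qed

lemma ident_prior_measurable: "(\<lambda>\<theta>. \<theta>) \<in> measurable \<pi> (restrict_space borel \<Theta>)"
proof (rule measurable_restrict_space2)
  have s: "sets \<pi> = sets (restrict_space borel K)" using prior by (simp add: priors_def)
  have "(\<lambda>\<theta>. \<theta>) \<in> measurable (restrict_space borel K) borel"
    by (intro measurable_restrict_space1) simp
  then show "(\<lambda>\<theta>. \<theta>) \<in> measurable \<pi> borel"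
    by (simp only: measurable_cong_sets[OF s refl])
qed (use space_prior K_subset in auto)

lemma lik_prior_measurable:
  "g \<in> measurable R (sample \<mu> k) \<Longrightarrow> (\<lambda>(\<theta>, x). lik p k \<theta> (g x)) \<in> borel_measurable (\<pi> \<Otimes>\<^sub>M R)"
  using lik_measurable_comp[OF measurable_compose[OF measurable_fst ident_prior_measurable]
      measurable_compose[OF measurable_snd]] by (simp add: split_def)

lemma lik_prior_measurable': "z \<in> space (sample \<mu> k) \<Longrightarrow> (\<lambda>\<theta>. lik p k \<theta> z) \<in> borel_measurable \<pi>"
  by (rule lik_measurable_comp[OF ident_prior_measurable]) simp

lemma pair_lik_prior_measurable:
  "(\<lambda>(\<theta>, xy). pair_lik N M \<theta> xy) \<in> borel_measurable (\<pi> \<Otimes>\<^sub>M pair_sample N M)"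
  using borel_measurable_times[OF lik_prior_measurable[OF measurable_fst] lik_prior_measurable[OF measurable_snd]]
  by (simp add: split_def)

lemma mix_measurable: "mix \<pi> p N \<in> borel_measurable (sample \<mu> N)"
proof -
  interpret prob_space \<pi> by (rule prob_prior)
  have "(\<lambda>(x, \<theta>). lik p N \<theta> x) \<in> borel_measurable (sample \<mu> N \<Otimes>\<^sub>M \<pi>)"
    using lik_measurable_comp[OF measurable_compose[OF measurable_snd ident_prior_measurable] measurable_fst]
    by (simp add: split_def)
  then show ?thesis unfolding mix_def by (rule borel_measurable_lebesgue_integral)
qed

lemma mix2_measurable: "(\<lambda>xy. mix2 \<pi> p N M (fst xy) (snd xy)) \<in> borel_measurable (pair_sample N M)"
proof -
  interpret prob_space \<pi> by (rule prob_prior)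
  have "(\<lambda>(xy, \<theta>). pair_lik N M \<theta> xy) \<in> borel_measurable (pair_sample N M \<Otimes>\<^sub>M \<pi>)"
    using borel_measurable_times[OF
       lik_measurable_comp[OF measurable_compose[OF measurable_snd ident_prior_measurable] measurable_compose[OF measurable_fst measurable_fst]]
       lik_measurable_comp[OF measurable_compose[OF measurable_snd ident_prior_measurable] measurable_compose[OF measurable_fst measurable_snd]]]
    by (simp add: split_def)
  then show ?thesis unfolding mix2_def by (rule borel_measurable_lebesgue_integral)
qed

text \<open>The envelope relative to one fixed point of K bounds the likelihood uniformly over K.
  Such a point exists because a probability space is nonempty.\<close>

lemma integrable_lik_prior:
  assumes z: "z \<in> space (sample \<mu> k)"
  shows "integrable \<pi> (\<lambda>\<theta>. lik p k \<theta> z)"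
proof -
  interpret prob_space \<pi> by (rule prob_prior)
  obtain \<theta>0 where th0: "\<theta>0 \<in> K" using not_empty space_prior by auto
  show ?thesis
  proof (rule integrable_const_bound)
    show "AE \<theta> in \<pi>. norm (lik p k \<theta> z) \<le> exp (Tsum k z) * lik p k \<theta>0 z"
      using lik_le[OF _ th0 z] lik_nonneg[OF _ z] K_subset space_prior by (intro AE_I2) auto
  qed (rule lik_prior_measurable'[OF z])
qed

text \<open>The envelope with its two parameters exchanged gives a positive lower bound that is
  constant over K.\<close>

lemma mix_pos:
  assumes x: "x \<in> space (sample \<mu> N)"
  shows "0 < mix \<pi> p N x"
proof -
  interpret prob_space \<pi> by (rule prob_prior)
  obtain \<theta>0 where th0: "\<theta>0 \<in> K" using not_empty space_prior by auto
  have "exp (- Tsum N x) * lik p N \<theta>0 x = (\<integral>\<theta>. exp (- Tsum N x) * lik p N \<theta>0 x \<partial>\<pi>)"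
    by (simp add: prob_space)
  also have "\<dots> \<le> mix \<pi> p N x"
    unfolding mix_def
  proof (intro integral_mono integrable_lik_prior[OF x])
    fix \<theta> assume "\<theta> \<in> space \<pi>"
    then have "\<theta> \<in> K" by (simp add: space_prior)
    from lik_le[OF _ this x, of \<theta>0] show "exp (- Tsum N x) * lik p N \<theta>0 x \<le> lik p N \<theta> x"
      using th0 K_subset by (auto simp: exp_minus field_simps)
  qed simp
  finally show ?thesis using lik_pos[OF th0 x] by (smt (verit) exp_gt_zero mult_pos_pos)
qed

text \<open>The predictive density is a weighted average of the values
  \<open>lik p M \<theta>' y\<close> with weights proportional to
  \<open>lik p N \<theta>' x\<close>. The envelope puts all these values within a factor
  \<open>exp (Tsum M y)\<close> of \<open>lik p M \<theta> y\<close>, hence their average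
  too.\<close>

lemma bayes_pred_bounds:
  assumes x: "x \<in> space (sample \<mu> N)" and y: "y \<in> space (sample \<mu> M)" and th: "\<theta> \<in> K"
  shows "0 < bayes_pred \<pi> p N M x y"
    and "\<bar>ln (bayes_pred \<pi> p N M x y) - ln (lik p M \<theta> y)\<bar> \<le> Tsum M y"
proof -
  interpret prob_space \<pi> by (rule prob_prior)
  let ?l = "lik p M \<theta> y" and ?e = "exp (Tsum M y)"
  have bd: "lik p M \<theta>' y \<le> ?e * ?l" "?l / ?e \<le> lik p M \<theta>' y" if "\<theta>' \<in> K" for \<theta>'
    using lik_le[OF _ th y, of \<theta>'] lik_le[OF _ that y, of \<theta>] that th K_subset by (auto simp: field_simps)
  have nn: "0 \<le> lik p N \<theta>' x" "0 \<le> lik p M \<theta>' y" if "\<theta>' \<in> K" for \<theta>'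
    using lik_pos[OF that x] lik_pos[OF that y] by auto
  have int: "integrable \<pi> (\<lambda>\<theta>'. lik p N \<theta>' x * c)" for c
    using integrable_lik_prior[OF x] by simp
  have int2: "integrable \<pi> (\<lambda>\<theta>'. lik p N \<theta>' x * lik p M \<theta>' y)"
  proof (rule Bochner_Integration.integrable_bound[OF int[of "?e * ?l"]])
    show "(\<lambda>\<theta>'. lik p N \<theta>' x * lik p M \<theta>' y) \<in> borel_measurable \<pi>"
      by (intro borel_measurable_times lik_prior_measurable' x y)
    show "AE \<theta>' in \<pi>. norm (lik p N \<theta>' x * lik p M \<theta>' y) \<le> norm (lik p N \<theta>' x * (?e * ?l))"
      using bd nn lik_pos[OF th y]
      by (intro AE_I2) (auto simp: space_prior abs_mult intro!: mult_left_mono)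
  qed
  have "mix2 \<pi> p N M x y \<le> (\<integral>\<theta>'. lik p N \<theta>' x * (?e * ?l) \<partial>\<pi>)"
    unfolding mix2_def using bd nn
    by (intro integral_mono int int2 mult_left_mono) (auto simp: space_prior)
  then have up: "bayes_pred \<pi> p N M x y \<le> ?e * ?l"
    using mix_pos[OF x] unfolding bayes_pred_def mix_def by (simp add: field_simps)
  have "(\<integral>\<theta>'. lik p N \<theta>' x * (?l / ?e) \<partial>\<pi>) \<le> mix2 \<pi> p N M x y"
    unfolding mix2_def using bd nn
    by (intro integral_mono int int2 mult_left_mono) (auto simp: space_prior)
  then have lo: "?l / ?e \<le> bayes_pred \<pi> p N M x y"
    using mix_pos[OF x] unfolding bayes_pred_def mix_def by (simp add: field_simps)
  have l: "0 < ?l" by (rule lik_pos[OF th y])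
  then show pos: "0 < bayes_pred \<pi> p N M x y" using lo by (smt (verit) divide_pos_pos exp_gt_zero)
  have "ln (bayes_pred \<pi> p N M x y) \<le> ln (?e * ?l)" "ln (?l / ?e) \<le> ln (bayes_pred \<pi> p N M x y)"
    using up lo l pos by (auto intro: ln_mono)
  then show "\<bar>ln (bayes_pred \<pi> p N M x y) - ln (lik p M \<theta> y)\<bar> \<le> Tsum M y"
    using l by (simp add: ln_mult ln_div)
qed

text \<open>Prepares Fubini for the prior and the two samples. The dominating function
  \<open>S\<close> does not depend on \<theta> and its expectations are bounded uniformly over K, so
  Tonelli with the prior outermost gives a finite integral.\<close>

lemma integrable_prior_pair:
  assumes S: "S \<in> borel_measurable (pair_sample N M)"
    and Sint: "\<And>\<theta>. \<theta> \<in> K \<Longrightarrow> integrable (pair_obs N M \<theta>) S"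
    and SB: "\<And>\<theta>. \<theta> \<in> K \<Longrightarrow> (\<integral>xy. S xy \<partial>pair_obs N M \<theta>) \<le> B"
    and G: "(\<lambda>(\<theta>, xy). G \<theta> xy) \<in> borel_measurable (\<pi> \<Otimes>\<^sub>M pair_sample N M)"
    and GS: "\<And>\<theta> xy. \<theta> \<in> K \<Longrightarrow> xy \<in> space (pair_sample N M) \<Longrightarrow> \<bar>G \<theta> xy\<bar> \<le> S xy"
  shows "integrable (\<pi> \<Otimes>\<^sub>M pair_sample N M) (\<lambda>(\<theta>, xy). pair_lik N M \<theta> xy * G \<theta> xy)"
    and "\<And>\<theta>. \<theta> \<in> K \<Longrightarrow> G \<theta> \<in> borel_measurable (pair_sample N M)"
    and "\<And>\<theta>. \<theta> \<in> K \<Longrightarrow> integrable (pair_obs N M \<theta>) (G \<theta>)"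
proof -
  interpret P: prob_space \<pi> by (rule prob_prior)
  interpret R: sigma_finite_measure "pair_sample N M" by (rule sigma_finite_pair_sample)
  show Gm: "G \<theta> \<in> borel_measurable (pair_sample N M)" if "\<theta> \<in> K" for \<theta>
    using measurable_compose[OF measurable_Pair1' G, of \<theta>] that by (simp add: space_prior)
  show "integrable (pair_obs N M \<theta>) (G \<theta>)" if th: "\<theta> \<in> K" for \<theta>
  proof (rule Bochner_Integration.integrable_bound[OF Sint[OF th]])
    show "G \<theta> \<in> borel_measurable (pair_obs N M \<theta>)"
      using Gm[OF th] by (simp add: measurable_cong_sets[OF sets_pair_obs refl])
    show "AE xy in pair_obs N M \<theta>. norm (G \<theta> xy) \<le> norm (S xy)"
      using GS[OF th] by (intro AE_I2) (force simp: space_pair_obs)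
  qed
  have m: "(\<lambda>(\<theta>, xy). pair_lik N M \<theta> xy * G \<theta> xy) \<in> borel_measurable (\<pi> \<Otimes>\<^sub>M pair_sample N M)"
    using borel_measurable_times[OF pair_lik_prior_measurable G] by (simp add: split_def)
  show "integrable (\<pi> \<Otimes>\<^sub>M pair_sample N M) (\<lambda>(\<theta>, xy). pair_lik N M \<theta> xy * G \<theta> xy)"
  proof (rule integrableI_bounded[OF m])
    have "(\<integral>\<^sup>+ t. ennreal (norm (case t of (\<theta>, xy) \<Rightarrow> pair_lik N M \<theta> xy * G \<theta> xy)) \<partial>(\<pi> \<Otimes>\<^sub>M pair_sample N M))
        = (\<integral>\<^sup>+ \<theta>. (\<integral>\<^sup>+ xy. ennreal (norm (pair_lik N M \<theta> xy * G \<theta> xy)) \<partial>pair_sample N M) \<partial>\<pi>)"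
      using m by (subst R.nn_integral_fst[symmetric]) (auto intro!: nn_integral_cong)
    also have "\<dots> \<le> (\<integral>\<^sup>+ \<theta>. ennreal B \<partial>\<pi>)"
    proof (intro nn_integral_mono)
      fix \<theta> assume "\<theta> \<in> space \<pi>"
      then have th: "\<theta> \<in> K" and th': "\<theta> \<in> \<Theta>" using space_prior K_subset by auto
      have "(\<integral>\<^sup>+ xy. ennreal (norm (pair_lik N M \<theta> xy * G \<theta> xy)) \<partial>pair_sample N M)
        \<le> (\<integral>\<^sup>+ xy. ennreal (pair_lik N M \<theta> xy) * ennreal (S xy) \<partial>pair_sample N M)"
      proof (intro nn_integral_mono)
        fix xy assume xy: "xy \<in> space (pair_sample N M)"
        have "norm (pair_lik N M \<theta> xy * G \<theta> xy) = pair_lik N M \<theta> xy * \<bar>G \<theta> xy\<bar>"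
          using pair_lik_nonneg[OF th' xy] by (simp only: real_norm_def abs_mult[of "pair_lik N M \<theta> xy"] abs_of_nonneg)
        also have "\<dots> \<le> pair_lik N M \<theta> xy * S xy"
          using pair_lik_nonneg[OF th' xy] GS[OF th xy] by (intro mult_left_mono)
        finally have "ennreal (norm (pair_lik N M \<theta> xy * G \<theta> xy)) \<le> ennreal (pair_lik N M \<theta> xy * S xy)"
          by (rule ennreal_leI)
        then show "ennreal (norm (pair_lik N M \<theta> xy * G \<theta> xy)) \<le> ennreal (pair_lik N M \<theta> xy) * ennreal (S xy)"
          using pair_lik_nonneg[OF th' xy] by (subst ennreal_mult'[symmetric]) auto
      qed
      also have "\<dots> = (\<integral>\<^sup>+ xy. ennreal (S xy) \<partial>pair_obs N M \<theta>)"
        \<comment> \<open>Absorbing the likelihood into the measure turns the weighted integral into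
          the expectation of \<open>S\<close>, where the uniform bound \<open>B\<close>
          applies.\<close>
        unfolding density_pair_lik[OF th', symmetric]
        using S pair_lik_measurable[OF th'] by (subst nn_integral_density) auto
      also have "\<dots> = ennreal (\<integral>xy. S xy \<partial>pair_obs N M \<theta>)"
        using GS[OF th] by (intro nn_integral_eq_integral Sint th AE_I2) (force simp: space_pair_obs)
      also have "\<dots> \<le> ennreal B" by (intro ennreal_leI SB th)
      finally show "(\<integral>\<^sup>+ xy. ennreal (norm (pair_lik N M \<theta> xy * G \<theta> xy)) \<partial>pair_sample N M) \<le> ennreal B" .
    qed
    also have "\<dots> < \<infinity>" by (simp add: P.emeasure_space_1)
    finally show "(\<integral>\<^sup>+ t. ennreal (norm (case t of (\<theta>, xy) \<Rightarrow> pair_lik N M \<theta> xy * G \<theta> xy)) \<partial>(\<pi> \<Otimes>\<^sub>M pair_sample N M)) < \<infinity>" .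
  qed
qed

end

subsection \<open>The sum of the two risks\<close>

abbreviation lnZ :: "nat \<Rightarrow> nat \<Rightarrow> (nat \<Rightarrow> 'x) \<Rightarrow> real" where
  "lnZ N M x \<equiv> ln (enn2real (cnml3_norm \<mu> p mle N M x))"

text \<open>Measures only the y part, although the estimator is fitted to x and y together; it can
  therefore be negative.\<close>

definition log_gain :: "nat \<Rightarrow> nat \<Rightarrow> 'a \<Rightarrow> (nat \<Rightarrow> 'x) \<times> (nat \<Rightarrow> 'x) \<Rightarrow> real" where
  "log_gain N M \<theta> xy = ln (lik p M (cmle N M (fst xy) (snd xy)) (snd xy)) - ln (lik p M \<theta> (snd xy))"

lemma lik_cmle_measurable:
  assumes "N + M \<ge> 1"
  shows "(\<lambda>xy. lik p M (cmle N M (fst xy) (snd xy)) (snd xy)) \<in> borel_measurable (pair_sample N M)"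
    and "(\<lambda>xy. lik p N (cmle N M (fst xy) (snd xy)) (fst xy)) \<in> borel_measurable (pair_sample N M)"
  using lik_measurable_comp[OF cmle_measurable[OF assms] measurable_snd]
    lik_measurable_comp[OF cmle_measurable[OF assms] measurable_fst]
  by (simp_all add: split_def)

lemma log_gain_measurable:
  assumes "N + M \<ge> 1" "\<theta> \<in> \<Theta>"
  shows "log_gain N M \<theta> \<in> borel_measurable (pair_sample N M)"
  unfolding log_gain_def
  by (intro borel_measurable_diff borel_measurable_ln lik_cmle_measurable assms
      measurable_compose[OF measurable_snd lik_measurable])

lemma log_gain_bound:
  assumes "N + M \<ge> 1" "\<theta> \<in> K" "xy \<in> space (pair_sample N M)"
  shows "\<bar>log_gain N M \<theta> xy\<bar> \<le> Tsum N (fst xy) + Tsum M (snd xy)"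
proof -
  have xy: "fst xy \<in> space (sample \<mu> N)" "snd xy \<in> space (sample \<mu> M)"
    using assms by (auto simp: space_pair_measure)
  show ?thesis unfolding log_gain_def
    using ln_lik_cmle_bounds[OF assms(1,2) xy] Tsum_nonneg[OF xy(1)] Tsum_nonneg[OF xy(2)] by auto
qed

lemma integrable_Tsum_pair:
  assumes "\<theta> \<in> \<Theta>" "integrable (obs \<theta>) T"
  shows "integrable (pair_obs N M \<theta>) (\<lambda>xy. Tsum N (fst xy))"
    and "integrable (pair_obs N M \<theta>) (\<lambda>xy. Tsum M (snd xy))"
    and "(\<integral>xy. Tsum N (fst xy) \<partial>pair_obs N M \<theta>) = real N * (\<integral>z. T z \<partial>obs \<theta>)"
    and "(\<integral>xy. Tsum M (snd xy) \<partial>pair_obs N M \<theta>) = real M * (\<integral>z. T z \<partial>obs \<theta>)"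
  using integrable_Tsum[OF assms] integral_Tsum[OF assms]
  by (simp_all add: integrable_pair_obs_fst[OF assms(1)] integrable_pair_obs_snd[OF assms(1)]
      integral_pair_obs_fst[OF assms(1)] integral_pair_obs_snd[OF assms(1)])

lemma integrable_log_gain:
  assumes NM: "N + M \<ge> 1" and th: "\<theta> \<in> K" and T: "integrable (obs \<theta>) T"
  shows "integrable (pair_obs N M \<theta>) (log_gain N M \<theta>)"
proof (rule Bochner_Integration.integrable_bound)
  have th': "\<theta> \<in> \<Theta>" using th K_subset by auto
  show "integrable (pair_obs N M \<theta>) (\<lambda>xy. Tsum N (fst xy) + Tsum M (snd xy))"
    by (intro Bochner_Integration.integrable_add integrable_Tsum_pair th' T)
  show "log_gain N M \<theta> \<in> borel_measurable (pair_obs N M \<theta>)"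
    using log_gain_measurable[OF NM th'] by (simp add: measurable_cong_sets[OF sets_pair_obs refl])
  show "AE xy in pair_obs N M \<theta>. norm (log_gain N M \<theta> xy) \<le> norm (Tsum N (fst xy) + Tsum M (snd xy))"
    using log_gain_bound[OF NM th] by (intro AE_I2) (force simp: space_pair_obs)
qed

lemma lnZ_measurable: "N + M \<ge> 1 \<Longrightarrow> lnZ N M \<in> borel_measurable (sample \<mu> N)"
  using cnml3_norm_measurable[of N M] by measurable

text \<open>The non-asymptotic core, for one M and one prior. The errors \<open>e1\<close> and
  \<open>e2\<close> are uniform over K, so the resulting bound is the same for every prior on K;
  \<open>c\<close> and \<open>d\<close> will be the constant of (A5) and half the dimension.\<close>

lemma risk_sum_close:
  fixes \<tau> c d e1 e2 :: real
  assumes prior: "\<pi> \<in> priors K" and NM: "N + M \<ge> 1"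
    and fin: "\<And>x. x \<in> space (sample \<mu> N) \<Longrightarrow> cnml3_norm \<mu> p mle N M x < \<infinity>"
    and Tint: "\<And>\<theta>. \<theta> \<in> K \<Longrightarrow> integrable (obs \<theta>) T"
    and Tbound: "\<And>\<theta>. \<theta> \<in> K \<Longrightarrow> (\<integral>z. T z \<partial>obs \<theta>) \<le> \<tau>"
    and Zint: "\<And>\<theta>. \<theta> \<in> K \<Longrightarrow> integrable (sample \<mu> N) (\<lambda>x. lik p N \<theta> x * lnZ N M x)"
    and Zclose: "\<And>\<theta>. \<theta> \<in> K \<Longrightarrow> \<bar>(\<integral>x. lik p N \<theta> x * lnZ N M x \<partial>sample \<mu> N) - c\<bar> \<le> e1"
    and gain: "\<And>\<theta>. \<theta> \<in> K \<Longrightarrow> \<bar>(\<integral>xy. log_gain N M \<theta> xy \<partial>pair_obs N M \<theta>) - d\<bar> \<le> e2"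
  shows "integrable (pair_sample N M) (Dq_integrand p \<pi> (q_cnml3 \<mu> p mle N M) N M)"
    and "integrable (\<pi> \<Otimes>\<^sub>M pair_sample N M) (KL_bayes_integrand p \<pi> N M)"
    and "\<bar>Dq \<mu> p \<pi> (q_cnml3 \<mu> p mle N M) N M + KL_risk_bayes \<mu> p \<pi> N M - (c - d)\<bar> \<le> e1 + e2"
proof -
  interpret P: prob_space \<pi> by (rule prob_prior[OF prior])
  interpret sN: sigma_finite_measure "sample \<mu> N" by (rule sigma_finite_sample[OF sigma_fin])
  interpret sM: sigma_finite_measure "sample \<mu> M" by (rule sigma_finite_sample[OF sigma_fin])
  interpret NMp: pair_sigma_finite "sample \<mu> N" "sample \<mu> M" ..
  interpret R: sigma_finite_measure "pair_sample N M" by (rule sigma_finite_pair_sample)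
  interpret PR: pair_sigma_finite \<pi> "pair_sample N M" ..
  have K\<Theta>: "\<theta> \<in> \<Theta>" if "\<theta> \<in> K" for \<theta> using that K_subset by auto
  let ?q = "q_cnml3 \<mu> p mle N M"
  \<comment> \<open>A common majorant of both logarithms. Comparing the predictive density with the
    likelihood at \<theta> costs \<open>Tsum M\<close> once; comparing the plugged-in likelihood
    with it costs \<open>Tsum M\<close> again from above or \<open>Tsum N\<close> from
    below.\<close>
  define S where "S xy = Tsum N (fst xy) + 2 * Tsum M (snd xy) + \<bar>lnZ N M (fst xy)\<bar>" for xy
  define g where "g xy = ln (mix2 \<pi> p N M (fst xy) (snd xy) / (?q (fst xy) (snd xy) * mix \<pi> p N (fst xy)))" for xy
  define h where "h \<theta> xy = ln (lik p M \<theta> (snd xy) / bayes_pred \<pi> p N M (fst xy) (snd xy))" for \<theta> xy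

  have g_eq: "g (x, y) = ln (bayes_pred \<pi> p N M x y) + lnZ N M x - ln (lik p M (cmle N M x y) y)"
    and h_eq: "h \<theta> (x, y) = ln (lik p M \<theta> y) - ln (bayes_pred \<pi> p N M x y)"
    if x: "x \<in> space (sample \<mu> N)" and y: "y \<in> space (sample \<mu> M)" and th: "\<theta> \<in> K" for x y \<theta>
  proof -
    note b = bayes_pred_bounds(1)[OF prior x y th]
    note v = lik_cmle_pos(2)[OF NM th x y]
    note z = ln_cnml3_norm_ge(1)[OF NM th x fin[OF x]]
    note m = mix_pos[OF prior x]
    \<comment> \<open>The marginal mixture of x turns the joint mixture into the predictive density,
      which is what the second risk contains.\<close>
    have "mix2 \<pi> p N M x y / (?q x y * mix \<pi> p N x)
      = bayes_pred \<pi> p N M x y * enn2real (cnml3_norm \<mu> p mle N M x) / lik p M (cmle N M x y) y"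
      using z m v by (simp add: bayes_pred_def q_cnml3_def field_simps)
    then show "g (x, y) = ln (bayes_pred \<pi> p N M x y) + lnZ N M x - ln (lik p M (cmle N M x y) y)"
      using b v z by (simp add: g_def ln_div ln_mult)
    show "h \<theta> (x, y) = ln (lik p M \<theta> y) - ln (bayes_pred \<pi> p N M x y)"
      using b lik_pos[OF th y] by (simp add: h_def ln_div)
  qed
  have g_bound: "\<bar>g xy\<bar> \<le> S xy" and h_bound: "\<bar>h \<theta> xy\<bar> \<le> S xy"
    and gh: "g xy + h \<theta> xy = lnZ N M (fst xy) - log_gain N M \<theta> xy"
    if th: "\<theta> \<in> K" and xy: "xy \<in> space (pair_sample N M)" for \<theta> xy
  proof -
    obtain x y where [simp]: "xy = (x, y)" by (cases xy)
    have x: "x \<in> space (sample \<mu> N)" and y: "y \<in> space (sample \<mu> M)"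
      using xy by (auto simp: space_pair_measure)
    note gh = g_eq[OF x y th] h_eq[OF x y th]
    note bd = bayes_pred_bounds(2)[OF prior x y th] ln_lik_cmle_bounds[OF NM th x y]
      Tsum_nonneg[OF x] Tsum_nonneg[OF y]
    show "\<bar>g xy\<bar> \<le> S xy" "\<bar>h \<theta> xy\<bar> \<le> S xy" using gh bd by (auto simp: S_def)
    \<comment> \<open>The predictive density cancels, and with it all dependence on the
      prior.\<close>
    show "g xy + h \<theta> xy = lnZ N M (fst xy) - log_gain N M \<theta> xy"
      using gh by (simp add: log_gain_def)
  qed

  have Z1: "integrable (sample (obs \<theta>) N) (lnZ N M)"
    and Z2: "\<bar>(\<integral>x. lnZ N M x \<partial>sample (obs \<theta>) N) - c\<bar> \<le> e1" if th: "\<theta> \<in> K" for \<theta>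
    using Zint[OF th] Zclose[OF th] integrable_lik[OF K\<Theta>[OF th] lnZ_measurable[OF NM]]
      integral_lik[OF K\<Theta>[OF th] lnZ_measurable[OF NM]] by auto
  have Z3: "integrable (pair_obs N M \<theta>) (\<lambda>xy. lnZ N M (fst xy))" if th: "\<theta> \<in> K" for \<theta>
    using Z1[OF th] integrable_pair_obs_fst[OF K\<Theta>[OF th] lnZ_measurable[OF NM]] by simp
  have Z4: "(\<integral>xy. lnZ N M (fst xy) \<partial>pair_obs N M \<theta>) = (\<integral>x. lnZ N M x \<partial>sample (obs \<theta>) N)" if th: "\<theta> \<in> K" for \<theta>
    by (rule integral_pair_obs_fst[OF K\<Theta>[OF th] lnZ_measurable[OF NM]])

  have S_meas: "S \<in> borel_measurable (pair_sample N M)"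
    unfolding S_def
    by (intro borel_measurable_add borel_measurable_times borel_measurable_abs borel_measurable_const
        measurable_compose[OF measurable_fst lnZ_measurable[OF NM]]
        measurable_compose[OF measurable_fst Tsum_measurable] measurable_compose[OF measurable_snd Tsum_measurable])
  have S_int: "integrable (pair_obs N M \<theta>) S" if th: "\<theta> \<in> K" for \<theta>
    unfolding S_def using integrable_Tsum_pair[OF K\<Theta>[OF th] Tint[OF th]] Z3[OF th]
    by (intro Bochner_Integration.integrable_add integrable_mult_right integrable_abs) auto
  have S_le: "(\<integral>xy. S xy \<partial>pair_obs N M \<theta>) \<le> (3 * real N + 2 * real M) * \<tau> + (c + e1)" if th: "\<theta> \<in> K" for \<theta>
  proof -
    note T = integrable_Tsum_pair[OF K\<Theta>[OF th] Tint[OF th]]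
    \<comment> \<open>Since lnZ is at least \<open>- Tsum N\<close>, its absolute value is at most
      lnZ + 2 \<open>Tsum N\<close>; this produces the coefficient 3. The mean of lnZ without
      absolute value is controlled by \<open>Zclose\<close>, uniformly over K.\<close>
    have "(\<integral>xy. S xy \<partial>pair_obs N M \<theta>)
        \<le> (\<integral>xy. 3 * Tsum N (fst xy) + 2 * Tsum M (snd xy) + lnZ N M (fst xy) \<partial>pair_obs N M \<theta>)"
    proof (rule integral_mono[OF S_int[OF th]])
      show "integrable (pair_obs N M \<theta>) (\<lambda>xy. 3 * Tsum N (fst xy) + 2 * Tsum M (snd xy) + lnZ N M (fst xy))"
        using T Z3[OF th] by (intro Bochner_Integration.integrable_add integrable_mult_right) auto
      fix xy assume "xy \<in> space (pair_obs N M \<theta>)"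
      then have x: "fst xy \<in> space (sample \<mu> N)" by (auto simp: space_pair_measure space_sample_obs)
      show "S xy \<le> 3 * Tsum N (fst xy) + 2 * Tsum M (snd xy) + lnZ N M (fst xy)"
        using ln_cnml3_norm_ge(2)[OF NM th x fin[OF x]] Tsum_nonneg[OF x] by (auto simp: S_def)
    qed
    also have "\<dots> = (3 * real N + 2 * real M) * (\<integral>z. T z \<partial>obs \<theta>) + (\<integral>x. lnZ N M x \<partial>sample (obs \<theta>) N)"
      using T Z3[OF th] Z4[OF th] by (simp add: algebra_simps)
    also have "\<dots> \<le> (3 * real N + 2 * real M) * \<tau> + (c + e1)"
      using Z2[OF th] mult_left_mono[OF Tbound[OF th], of "3 * real N + 2 * real M"] by auto
    finally show ?thesis .
  qed

  have bayes_meas: "(\<lambda>xy. bayes_pred \<pi> p N M (fst xy) (snd xy)) \<in> borel_measurable (pair_sample N M)"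
    unfolding bayes_pred_def
    by (intro borel_measurable_divide mix2_measurable[OF prior] measurable_compose[OF measurable_fst mix_measurable[OF prior]])
  have Z_meas: "(\<lambda>x. enn2real (cnml3_norm \<mu> p mle N M x)) \<in> borel_measurable (sample \<mu> N)"
    using cnml3_norm_measurable[OF NM] by measurable
  have g_meas0: "g \<in> borel_measurable (pair_sample N M)"
    unfolding g_def q_cnml3_def
    by (intro borel_measurable_ln borel_measurable_divide borel_measurable_times mix2_measurable[OF prior]
        measurable_compose[OF measurable_fst mix_measurable[OF prior]] lik_cmle_measurable NM
        measurable_compose[OF measurable_fst Z_meas])
  have g_meas: "(\<lambda>(\<theta>, xy). g xy) \<in> borel_measurable (\<pi> \<Otimes>\<^sub>M pair_sample N M)"
    using measurable_compose[OF measurable_snd g_meas0] by (simp add: split_def)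
  have h_meas: "(\<lambda>(\<theta>, xy). h \<theta> xy) \<in> borel_measurable (\<pi> \<Otimes>\<^sub>M pair_sample N M)"
    using borel_measurable_ln[OF borel_measurable_divide[OF lik_prior_measurable[OF prior measurable_snd]
          measurable_compose[OF measurable_snd bayes_meas]]]
    by (simp add: h_def split_def)

  have Gi: "integrable (\<pi> \<Otimes>\<^sub>M pair_sample N M) (\<lambda>(\<theta>, xy). pair_lik N M \<theta> xy * g xy)"
    "\<And>\<theta>. \<theta> \<in> K \<Longrightarrow> integrable (pair_obs N M \<theta>) g"
    using integrable_prior_pair(1,3)[where G = "\<lambda>_. g", OF prior S_meas S_int S_le g_meas] g_bound by blast+
  have Hi: "integrable (\<pi> \<Otimes>\<^sub>M pair_sample N M) (\<lambda>(\<theta>, xy). pair_lik N M \<theta> xy * h \<theta> xy)"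
    "\<And>\<theta>. \<theta> \<in> K \<Longrightarrow> h \<theta> \<in> borel_measurable (pair_sample N M)"
    "\<And>\<theta>. \<theta> \<in> K \<Longrightarrow> integrable (pair_obs N M \<theta>) (h \<theta>)"
    using integrable_prior_pair[where G = h, OF prior S_meas S_int S_le h_meas] h_bound by blast+

  \<comment> \<open>The logarithm \<open>g\<close> is free of \<theta>, so it moves inside the prior
    integral that defines the joint mixture. The order of integration can then be exchanged.\<close>
  have Dq_eq: "Dq_integrand p \<pi> ?q N M = (\<lambda>xy. \<integral>\<theta>. pair_lik N M \<theta> xy * g xy \<partial>\<pi>)"
    by (simp add: fun_eq_iff Dq_integrand_def g_def mix2_def)
  show "integrable (pair_sample N M) (Dq_integrand p \<pi> ?q N M)"
    unfolding Dq_eq by (rule PR.integrable_snd[OF Gi(1)])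
  have KL_eq: "KL_bayes_integrand p \<pi> N M = (\<lambda>(\<theta>, xy). pair_lik N M \<theta> xy * h \<theta> xy)"
    by (auto simp: fun_eq_iff KL_bayes_integrand_def h_def)
  show "integrable (\<pi> \<Otimes>\<^sub>M pair_sample N M) (KL_bayes_integrand p \<pi> N M)"
    unfolding KL_eq by (rule Hi(1))

  define G where "G \<theta> = (\<integral>xy. pair_lik N M \<theta> xy * g xy \<partial>pair_sample N M)" for \<theta>
  define H where "H \<theta> = (\<integral>xy. pair_lik N M \<theta> xy * h \<theta> xy \<partial>pair_sample N M)" for \<theta>
  have Gint: "integrable \<pi> G" unfolding G_def by (rule PR.integrable_fst[OF Gi(1)])
  have Hint: "integrable \<pi> H" unfolding H_def by (rule PR.integrable_fst[OF Hi(1)])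
  have "Dq \<mu> p \<pi> ?q N M = (\<integral>xy. Dq_integrand p \<pi> ?q N M xy \<partial>pair_sample N M)"
    by (simp add: Dq_def Dq_integrand_def)
  also have "\<dots> = (\<integral>\<theta>. G \<theta> \<partial>\<pi>)"
    unfolding Dq_eq G_def by (rule PR.Fubini_integral[OF Gi(1)])
  finally have D: "Dq \<mu> p \<pi> ?q N M = (\<integral>\<theta>. G \<theta> \<partial>\<pi>)" .
  have "KL_risk_bayes \<mu> p \<pi> N M = (\<integral>\<theta>. H \<theta> \<partial>\<pi>)"
    unfolding KL_risk_bayes_def
  proof (rule Bochner_Integration.integral_cong[OF refl])
    fix \<theta> assume "\<theta> \<in> space \<pi>"
    then have th: "\<theta> \<in> K" by (simp add: space_prior[OF prior])
    \<comment> \<open>The risk is an iterated integral over x and y; integrability for this fixed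
      \<theta> identifies it with the joint one.\<close>
    have "integrable (pair_sample N M) (\<lambda>xy. pair_lik N M \<theta> xy * h \<theta> xy)"
      using Hi(3)[OF th] integrable_pair_lik[OF K\<Theta>[OF th] Hi(2)[OF th]] by simp
    then have int: "integrable (pair_sample N M) (\<lambda>(x, y). lik p N \<theta> x * (lik p M \<theta> y * h \<theta> (x, y)))"
      by (simp add: split_def mult.assoc)
    have "KL_risk \<mu> p (bayes_pred \<pi> p N M) N M \<theta>
      = (\<integral>x. \<integral>y. lik p N \<theta> x * (lik p M \<theta> y * h \<theta> (x, y)) \<partial>sample \<mu> M \<partial>sample \<mu> N)"
      by (simp add: KL_risk_def h_def)
    also have "\<dots> = H \<theta>"
      using NMp.integral_fst[OF int] by (simp add: H_def split_def mult.assoc)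
    finally show "KL_risk \<mu> p (bayes_pred \<pi> p N M) N M \<theta> = H \<theta>" .
  qed
  then have sum: "Dq \<mu> p \<pi> ?q N M + KL_risk_bayes \<mu> p \<pi> N M = (\<integral>\<theta>. G \<theta> + H \<theta> \<partial>\<pi>)"
    using D Gint Hint by simp
  have GH: "\<bar>G \<theta> + H \<theta> - (c - d)\<bar> \<le> e1 + e2" if th: "\<theta> \<in> K" for \<theta>
  proof -
    have "G \<theta> + H \<theta> = (\<integral>xy. g xy \<partial>pair_obs N M \<theta>) + (\<integral>xy. h \<theta> xy \<partial>pair_obs N M \<theta>)"
      unfolding G_def H_def
      by (simp add: integral_pair_lik[OF K\<Theta>[OF th] Hi(2)[OF th]] integral_pair_lik[OF K\<Theta>[OF th] g_meas0])
    also have "\<dots> = (\<integral>xy. g xy + h \<theta> xy \<partial>pair_obs N M \<theta>)"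
      using Gi(2)[OF th] Hi(3)[OF th] by simp
    also have "\<dots> = (\<integral>xy. lnZ N M (fst xy) - log_gain N M \<theta> xy \<partial>pair_obs N M \<theta>)"
      using gh[OF th] by (intro Bochner_Integration.integral_cong) (auto simp: space_pair_obs)
    also have "\<dots> = (\<integral>x. lnZ N M x \<partial>sample (obs \<theta>) N) - (\<integral>xy. log_gain N M \<theta> xy \<partial>pair_obs N M \<theta>)"
      using Z3[OF th] Z4[OF th] integrable_log_gain[OF NM th Tint[OF th]] by simp
    finally show ?thesis using Z2[OF th] gain[OF th] by linarith
  qed
  have GHint: "integrable \<pi> (\<lambda>\<theta>. G \<theta> + H \<theta>)" using Gint Hint by simp
  \<comment> \<open>A two-sided bound uniform over K survives averaging, as the prior is a
    probability measure on K.\<close>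
  have "(\<integral>\<theta>. G \<theta> + H \<theta> \<partial>\<pi>) \<le> (\<integral>\<theta>. (c - d) + (e1 + e2) \<partial>\<pi>)"
    using GH by (intro integral_mono[OF GHint]) (fastforce simp: space_prior[OF prior])+
  moreover have "(\<integral>\<theta>. (c - d) - (e1 + e2) \<partial>\<pi>) \<le> (\<integral>\<theta>. G \<theta> + H \<theta> \<partial>\<pi>)"
    using GH by (intro integral_mono[OF _ GHint]) (fastforce simp: space_prior[OF prior])+
  ultimately show "\<bar>Dq \<mu> p \<pi> ?q N M + KL_risk_bayes \<mu> p \<pi> N M - (c - d)\<bar> \<le> e1 + e2"
    unfolding sum by (simp add: P.prob_space abs_le_iff)
qed

subsection \<open>Moments and consistency\<close>

text \<open>Separates essentially bounded functions from those with a finite moment of real order,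
  with one constant for all of K. The essential bound passes from \<mu> to each
  \<open>obs \<theta>\<close> by absolute continuity.\<close>

lemma moment_boundE:
  assumes mom: "moment_bound \<mu> p K F a" and a: "1 \<le> a" and F[measurable]: "F \<in> borel_measurable \<mu>"
  obtains (ess) c where "a = \<infinity>" "0 \<le> c" "\<And>\<theta>. \<theta> \<in> K \<Longrightarrow> AE z in obs \<theta>. F z \<le> c"
  | (fin) \<rho> B where "a = ereal \<rho>" "1 \<le> \<rho>" "0 \<le> B"
      "\<And>\<theta>. \<theta> \<in> K \<Longrightarrow> (\<integral>\<^sup>+ z. ennreal (F z powr \<rho>) \<partial>obs \<theta>) \<le> ennreal B"
proof (cases "a = \<infinity>")
  case True
  then have less: "esssup \<mu> (\<lambda>z. ereal (F z)) < \<infinity>" using mom by (simp add: moment_bound_def)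
  obtain c where c: "esssup \<mu> (\<lambda>z. ereal (F z)) \<le> ereal c" "0 \<le> c"
  proof (cases "esssup \<mu> (\<lambda>z. ereal (F z))")
    case (real r)
    then show ?thesis using that[of "max r 0"] by simp
  next
    case PInf then show ?thesis using less by simp
  next
    case MInf then show ?thesis using that[of 0] by simp
  qed
  have "AE z in \<mu>. ereal (F z) \<le> esssup \<mu> (\<lambda>z. ereal (F z))" by (rule esssup_AE)
  then have "AE z in \<mu>. F z \<le> c"
  proof eventually_elim
    case (elim z)
    then have "ereal (F z) \<le> ereal c" using c(1) by (rule order_trans)
    then show ?case by simp
  qed
  then have "AE z in obs \<theta>. F z \<le> c" if "\<theta> \<in> K" for \<theta>
    unfolding obs_def using p_measurable[of \<theta>] that K_subset by (subst AE_density) auto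
  then show ?thesis using True c(2) ess by auto
next
  case False
  then obtain \<rho> where \<rho>: "a = ereal \<rho>" using a by (cases a) auto
  let ?S = "\<Squnion>\<theta>\<in>K. \<integral>\<^sup>+ z. ennreal (p \<theta> z * F z powr \<rho>) \<partial>\<mu>"
  have "?S < \<infinity>" using mom \<rho> by (simp add: moment_bound_def)
  then obtain B where B: "?S = ennreal B" "0 \<le> B" by (cases ?S) auto
  have "(\<integral>\<^sup>+ z. ennreal (F z powr \<rho>) \<partial>obs \<theta>) \<le> ennreal B" if th: "\<theta> \<in> K" for \<theta>
  proof -
    have "(\<integral>\<^sup>+ z. ennreal (F z powr \<rho>) \<partial>obs \<theta>) = (\<integral>\<^sup>+ z. ennreal (p \<theta> z) * ennreal (F z powr \<rho>) \<partial>\<mu>)"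
      unfolding obs_def using p_measurable[of \<theta>] th K_subset by (intro nn_integral_density) auto
    also have "\<dots> = (\<integral>\<^sup>+ z. ennreal (p \<theta> z * F z powr \<rho>) \<partial>\<mu>)"
      using p_pos[OF th] by (intro nn_integral_cong) (simp add: ennreal_mult less_imp_le)
    also have "\<dots> \<le> ?S" using th by (rule SUP_upper)
    finally show ?thesis using B by simp
  qed
  then show ?thesis using fin[OF \<rho> _ B(2)] a \<rho> by auto
qed

lemma moment_integrable:
  assumes mom: "moment_bound \<mu> p K F a" and a: "1 \<le> a" and F[measurable]: "F \<in> borel_measurable \<mu>"
    and F0: "\<And>z. z \<in> space \<mu> \<Longrightarrow> 0 \<le> F z"
  obtains b where "0 \<le> b" "\<And>\<theta>. \<theta> \<in> K \<Longrightarrow> integrable (obs \<theta>) F" "\<And>\<theta>. \<theta> \<in> K \<Longrightarrow> (\<integral>z. F z \<partial>obs \<theta>) \<le> b"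
proof -
  have F': "F \<in> borel_measurable (obs \<theta>)" for \<theta> using F by (simp add: obs_def)
  have "\<exists>b\<ge>0. \<forall>\<theta>\<in>K. (\<integral>\<^sup>+ z. ennreal (F z) \<partial>obs \<theta>) \<le> ennreal b"
    using mom a F
  proof (cases rule: moment_boundE)
    case (ess c)
    have "(\<integral>\<^sup>+ z. ennreal (F z) \<partial>obs \<theta>) \<le> ennreal c" if th: "\<theta> \<in> K" for \<theta>
    proof -
      interpret prob_space "obs \<theta>" using th K_subset by (intro prob_obs) auto
      have "(\<integral>\<^sup>+ z. ennreal (F z) \<partial>obs \<theta>) \<le> (\<integral>\<^sup>+ z. ennreal c \<partial>obs \<theta>)"
        using ess(3)[OF th] by (intro nn_integral_mono_AE) (auto intro: ennreal_leI)
      then show ?thesis by (simp add: emeasure_space_1)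
    qed
    then show ?thesis using ess(2) by auto
  next
    case (fin \<rho> B)
    have "(\<integral>\<^sup>+ z. ennreal (F z) \<partial>obs \<theta>) \<le> ennreal (1 + B)" if th: "\<theta> \<in> K" for \<theta>
    proof -
      interpret prob_space "obs \<theta>" using th K_subset by (intro prob_obs) auto
      have "(\<integral>\<^sup>+ z. ennreal (F z) \<partial>obs \<theta>) \<le> (\<integral>\<^sup>+ z. 1 + ennreal (F z powr \<rho>) \<partial>obs \<theta>)"
      proof (intro nn_integral_mono)
        fix z assume z: "z \<in> space (obs \<theta>)"
        \<comment> \<open>Bounds the first moment by a moment of order \<rho> \<ge> 1 on a
          probability space, without an appeal to Jensen.\<close>
        have "F z \<le> 1 + F z powr \<rho>"
        proof (cases "F z \<le> 1")
          case False
          then have "F z powr 1 \<le> F z powr \<rho>" using fin(2) by (intro powr_mono) auto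
          then show ?thesis using False by simp
        next
          case True
          then show ?thesis by (smt (verit) powr_ge_zero)
        qed
        then have "ennreal (F z) \<le> ennreal (1 + F z powr \<rho>)" by (rule ennreal_leI)
        then show "ennreal (F z) \<le> 1 + ennreal (F z powr \<rho>)" by simp
      qed
      also have "\<dots> = 1 + (\<integral>\<^sup>+ z. ennreal (F z powr \<rho>) \<partial>obs \<theta>)"
        using F' by (subst nn_integral_add) (auto simp: emeasure_space_1)
      also have "\<dots> \<le> 1 + ennreal B" by (intro add_left_mono fin th)
      finally show ?thesis using fin(3) by simp
    qed
    then show ?thesis using fin(3) by (intro exI[of _ "1 + B"]) auto
  qed
  then obtain b where b: "0 \<le> b" "\<And>\<theta>. \<theta> \<in> K \<Longrightarrow> (\<integral>\<^sup>+ z. ennreal (F z) \<partial>obs \<theta>) \<le> ennreal b" by auto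
  show ?thesis
    using F0 by (intro that[OF b(1)] integrable_le_of_nn_integral_le[OF F' _ b(2) b(1)]) (auto simp: space_obs)
qed

text \<open>A bounded moment of order above 1 makes the mean excess over a high level small
  uniformly over K; an essentially bounded function has no excess at all beyond its bound.\<close>

lemma moment_uniformly_integrable:
  assumes mom: "moment_bound \<mu> p K F a" and a: "1 < a" and F[measurable]: "F \<in> borel_measurable \<mu>"
    and F0: "\<And>z. z \<in> space \<mu> \<Longrightarrow> 0 \<le> F z" and s: "0 < s"
  obtains c where "0 \<le> c" "\<And>\<theta>. \<theta> \<in> K \<Longrightarrow> integrable (obs \<theta>) (\<lambda>z. max (F z - c) 0)"
    "\<And>\<theta>. \<theta> \<in> K \<Longrightarrow> (\<integral>z. max (F z - c) 0 \<partial>obs \<theta>) \<le> s"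
proof -
  have F': "F \<in> borel_measurable (obs \<theta>)" for \<theta> using F by (simp add: obs_def)
  have "\<exists>c\<ge>0. \<forall>\<theta>\<in>K. (\<integral>\<^sup>+ z. ennreal (max (F z - c) 0) \<partial>obs \<theta>) \<le> ennreal s"
    using mom less_imp_le[OF a] F
  proof (cases rule: moment_boundE)
    case (ess c)
    have "(\<integral>\<^sup>+ z. ennreal (max (F z - c) 0) \<partial>obs \<theta>) = 0" if th: "\<theta> \<in> K" for \<theta>
    proof (subst nn_integral_0_iff_AE)
      show "AE z in obs \<theta>. ennreal (max (F z - c) 0) = 0"
        using ess(3)[OF th] by eventually_elim auto
    qed (use F' in measurable)
    then show ?thesis using ess(2) by auto
  next
    case (fin \<rho> B)
    then have \<rho>: "1 < \<rho>" using a by simp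
    \<comment> \<open>The level \<open>c\<close> is such that F > c implies F \<le> t F^\<rho>, so
      the mean excess is at most \<open>t * B\<close>, which \<open>t\<close> keeps below
      \<open>s\<close>. The \<open>+ 1\<close> guards against \<open>B = 0\<close>.\<close>
    define t where "t = s / (B + 1)"
    have t: "0 < t" "t * B \<le> s" using s fin(3) by (auto simp: t_def field_simps)
    define c where "c = (1 / t) powr (1 / (\<rho> - 1))"
    have c: "0 < c" "c powr (\<rho> - 1) = 1 / t" using t \<rho> by (auto simp: c_def powr_powr)
    have "(\<integral>\<^sup>+ z. ennreal (max (F z - c) 0) \<partial>obs \<theta>) \<le> ennreal s" if th: "\<theta> \<in> K" for \<theta>
    proof -
      have "(\<integral>\<^sup>+ z. ennreal (max (F z - c) 0) \<partial>obs \<theta>) \<le> (\<integral>\<^sup>+ z. ennreal t * ennreal (F z powr \<rho>) \<partial>obs \<theta>)"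
      proof (intro nn_integral_mono)
        fix z assume "z \<in> space (obs \<theta>)"
        have "max (F z - c) 0 \<le> t * F z powr \<rho>"
        proof (cases "F z \<le> c")
          case False
          then have "1 / t \<le> F z powr (\<rho> - 1)"
            unfolding c(2)[symmetric] using c(1) \<rho> by (intro powr_mono2) auto
          then have "F z * (1 / t) \<le> F z * F z powr (\<rho> - 1)" using False c(1) by (intro mult_left_mono) auto
          also have "\<dots> = F z powr \<rho>" using False c(1) powr_add[of "F z" 1 "\<rho> - 1"] by simp
          finally have "F z \<le> t * F z powr \<rho>" using t by (simp add: field_simps)
          then show ?thesis using False c by auto
        qed (use t in auto)
        then have "ennreal (max (F z - c) 0) \<le> ennreal (t * F z powr \<rho>)" by (rule ennreal_leI)
        then show "ennreal (max (F z - c) 0) \<le> ennreal t * ennreal (F z powr \<rho>)"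
          using t by (simp add: ennreal_mult)
      qed
      also have "\<dots> = ennreal t * (\<integral>\<^sup>+ z. ennreal (F z powr \<rho>) \<partial>obs \<theta>)"
        using F' by (intro nn_integral_cmult) auto
      also have "\<dots> \<le> ennreal t * ennreal B" by (intro mult_left_mono fin th) auto
      also have "\<dots> = ennreal (t * B)" using t fin(3) by (simp add: ennreal_mult)
      also have "\<dots> \<le> ennreal s" using t by (intro ennreal_leI)
      finally show ?thesis .
    qed
    then show ?thesis using c(1) by (intro exI[of _ c]) auto
  qed
  then obtain c where c: "0 \<le> c" "\<And>\<theta>. \<theta> \<in> K \<Longrightarrow> (\<integral>\<^sup>+ z. ennreal (max (F z - c) 0) \<partial>obs \<theta>) \<le> ennreal s"
    by auto
  have m: "(\<lambda>z. max (F z - c) 0) \<in> borel_measurable (obs \<theta>)" for \<theta> using F' by measurable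
  show ?thesis
    using s by (intro that[OF c(1)] integrable_le_of_nn_integral_le[OF m _ c(2)]) auto
qed

lemma mle_far_measurable:
  assumes "k \<ge> 1"
  shows "{z \<in> space (sample \<mu> k). norm (mle k z - \<theta>) > \<eta>} \<in> sets (sample (obs \<theta>') k)"
proof -
  have [measurable]: "mle k \<in> borel_measurable (sample \<mu> k)" by (rule mle_meas[OF assms])
  show ?thesis unfolding sets_sample_obs by measurable
qed

text \<open>Markov's inequality applied to the moment of order \<beta> in (A2). For \<alpha> = 1 the
  exponent \<beta> is infinite, and the far event is eventually null.\<close>

lemma mle_consistent:
  assumes A2: "A2_cond \<mu> p K mle (conj_exp \<alpha>)" and alpha: "1 \<le> \<alpha>" and eta: "0 < \<eta>" and s: "0 < s"
  shows "eventually (\<lambda>k. \<forall>\<theta>\<in>K.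
    measure (sample (obs \<theta>) k) {z \<in> space (sample \<mu> k). norm (mle k z - \<theta>) > \<eta>} \<le> s) sequentially"
proof (cases "\<alpha> = 1")
  case True
  then have "(\<lambda>k. \<Squnion>\<theta>\<in>K. esssup (density (sample \<mu> k) (\<lambda>z. ennreal (lik p k \<theta> z)))
                             (\<lambda>z. ennreal (norm (mle k z - \<theta>)))) \<longlonglongrightarrow> 0"
    using A2 by (simp add: A2_cond_def conj_exp_def)
  then have "eventually (\<lambda>k. (\<Squnion>\<theta>\<in>K. esssup (density (sample \<mu> k) (\<lambda>z. ennreal (lik p k \<theta> z)))
                             (\<lambda>z. ennreal (norm (mle k z - \<theta>)))) < ennreal \<eta>) sequentially"
    using eta by (intro order_tendstoD(2)) auto
  then show ?thesis using eventually_ge_at_top[of "1::nat"]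
  proof eventually_elim
    case (elim k)
    show ?case
    proof
      fix \<theta> assume th: "\<theta> \<in> K"
      then have th': "\<theta> \<in> \<Theta>" using K_subset by auto
      let ?A = "{z \<in> space (sample \<mu> k). norm (mle k z - \<theta>) > \<eta>}"
      let ?E = "esssup (density (sample \<mu> k) (\<lambda>z. ennreal (lik p k \<theta> z))) (\<lambda>z. ennreal (norm (mle k z - \<theta>)))"
      have E: "?E < ennreal \<eta>" using elim(1) SUP_upper[OF th] le_less_trans by blast
      have "AE z in sample (obs \<theta>) k. ennreal (norm (mle k z - \<theta>)) \<le> ?E"
        unfolding density_lik[OF th'] by (rule esssup_AE)
      then have "AE z in sample (obs \<theta>) k. z \<notin> ?A"
      proof eventually_elim
        case (elim z)
        then have "ennreal (norm (mle k z - \<theta>)) < ennreal \<eta>" using E by (rule le_less_trans)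
        then show ?case by (simp add: ennreal_less_iff)
      qed
      then have "emeasure (sample (obs \<theta>) k) ?A = 0"
        using AE_iff_null_sets[OF mle_far_measurable[OF elim(2)], of \<eta> \<theta> \<theta>] by blast
      then show "measure (sample (obs \<theta>) k) ?A \<le> s" using s by (simp add: measure_def)
    qed
  qed
next
  case False
  define b where "b = real_of_ereal (conj_exp \<alpha>)"
  \<comment> \<open>Excluding \<alpha> = 1 leaves a finite conjugate exponent, equal to 1 when
    \<alpha> is infinite.\<close>
  have b: "0 < b \<and> conj_exp \<alpha> \<noteq> \<infinity>"
  proof (cases \<alpha>)
    case (real r)
    then have "1 < r" using alpha False by (auto simp: le_less one_ereal_def)
    then show ?thesis using real by (auto simp: b_def conj_exp_def one_ereal_def)
  qed (use alpha in \<open>auto simp: b_def conj_exp_def one_ereal_def\<close>)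
  have "(\<lambda>k. \<Squnion>\<theta>\<in>K. \<integral>\<^sup>+ z. ennreal (lik p k \<theta> z * norm (mle k z - \<theta>) powr b) \<partial>sample \<mu> k) \<longlonglongrightarrow> 0"
    using A2 b by (simp add: A2_cond_def b_def)
  then have "eventually (\<lambda>k. (\<Squnion>\<theta>\<in>K. \<integral>\<^sup>+ z. ennreal (lik p k \<theta> z * norm (mle k z - \<theta>) powr b) \<partial>sample \<mu> k)
      < ennreal (\<eta> powr b * s)) sequentially"
    using eta s by (intro order_tendstoD(2)) auto
  then show ?thesis using eventually_ge_at_top[of "1::nat"]
  proof eventually_elim
    case (elim k)
    show ?case
    proof
      fix \<theta> assume th: "\<theta> \<in> K"
      then have th': "\<theta> \<in> \<Theta>" using K_subset by auto
      interpret P: prob_space "sample (obs \<theta>) k" by (intro prob_space_sample prob_obs th')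
      let ?A = "{z \<in> space (sample \<mu> k). norm (mle k z - \<theta>) > \<eta>}"
      note A = mle_far_measurable[OF elim(2), of \<eta> \<theta> \<theta>]
      have [measurable]: "mle k \<in> borel_measurable (sample \<mu> k)" "lik p k \<theta> \<in> borel_measurable (sample \<mu> k)"
        by (rule mle_meas[OF elim(2)] lik_measurable[OF th'])+
      have "ennreal (\<eta> powr b) * emeasure (sample (obs \<theta>) k) ?A
          = (\<integral>\<^sup>+ z. ennreal (\<eta> powr b) * indicator ?A z \<partial>sample (obs \<theta>) k)"
        using A by (simp add: nn_integral_cmult_indicator)
      also have "\<dots> \<le> (\<integral>\<^sup>+ z. ennreal (norm (mle k z - \<theta>) powr b) \<partial>sample (obs \<theta>) k)"
        using eta b by (intro nn_integral_mono) (auto simp: indicator_def intro!: ennreal_leI powr_mono2)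
      also have "\<dots> = (\<integral>\<^sup>+ z. ennreal (lik p k \<theta> z) * ennreal (norm (mle k z - \<theta>) powr b) \<partial>sample \<mu> k)"
        unfolding density_lik[OF th', symmetric] by (intro nn_integral_density) measurable
      also have "\<dots> = (\<integral>\<^sup>+ z. ennreal (lik p k \<theta> z * norm (mle k z - \<theta>) powr b) \<partial>sample \<mu> k)"
        using lik_nonneg[OF th'] by (intro nn_integral_cong) (simp add: ennreal_mult)
      also have "\<dots> \<le> (\<Squnion>\<theta>\<in>K. \<integral>\<^sup>+ z. ennreal (lik p k \<theta> z * norm (mle k z - \<theta>) powr b) \<partial>sample \<mu> k)"
        using th by (rule SUP_upper)
      also have "\<dots> < ennreal (\<eta> powr b * s)" by (rule elim(1))
      finally have "ennreal (\<eta> powr b * measure (sample (obs \<theta>) k) ?A) \<le> ennreal (\<eta> powr b * s)"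
        by (simp add: P.emeasure_eq_measure ennreal_mult less_imp_le)
      then show "measure (sample (obs \<theta>) k) ?A \<le> s" using eta s by simp
    qed
  qed
qed

subsection \<open>The expected log-likelihood gain\<close>

text \<open>The log-likelihood ratio of (A4), half of Wilks' statistic, whose classical limiting
  mean d accounts for the d/2.\<close>

definition full_gain :: "nat \<Rightarrow> 'a \<Rightarrow> (nat \<Rightarrow> 'x) \<Rightarrow> real" where
  "full_gain k \<theta> z = ln (lik p k (mle k z) z) - ln (lik p k \<theta> z)"

context
  fixes k :: nat and \<theta> :: 'a
  assumes k: "k \<ge> 1" and th: "\<theta> \<in> K"
begin

lemma lik_mle_pos: "z \<in> space (sample \<mu> k) \<Longrightarrow> 0 < lik p k (mle k z) z"
  using lik_pos[OF th] mle_max[OF k] th K_subset by (metis less_le_trans subsetD)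

lemma full_gain_bounds:
  assumes z: "z \<in> space (sample \<mu> k)"
  shows "0 \<le> full_gain k \<theta> z" "full_gain k \<theta> z \<le> Tsum k z"
proof -
  note l = lik_pos[OF th z] and m = lik_mle_pos[OF z]
  show "0 \<le> full_gain k \<theta> z"
    using mle_max[OF k z, of \<theta>] l th K_subset by (auto simp: full_gain_def intro!: ln_mono)
  have "ln (lik p k (mle k z) z) \<le> ln (exp (Tsum k z) * lik p k \<theta> z)"
    using lik_le[OF mle_in[OF k z] th z] m by (intro ln_mono) auto
  then show "full_gain k \<theta> z \<le> Tsum k z" using l by (simp add: full_gain_def ln_mult)
qed

lemma full_gain_measurable: "full_gain k \<theta> \<in> borel_measurable (sample \<mu> k)"
  unfolding full_gain_def using th K_subset
  by (intro borel_measurable_diff borel_measurable_ln lik_measurable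
      lik_measurable_comp[OF mle_measurable[OF k] measurable_ident_sets]) auto

lemma integrable_full_gain:
  assumes T: "integrable (obs \<theta>) T"
  shows "integrable (sample (obs \<theta>) k) (full_gain k \<theta>)"
proof (rule Bochner_Integration.integrable_bound)
  show "integrable (sample (obs \<theta>) k) (Tsum k)"
    using th K_subset by (intro integrable_Tsum T) auto
  show "full_gain k \<theta> \<in> borel_measurable (sample (obs \<theta>) k)"
    using full_gain_measurable by (simp add: measurable_cong_sets[OF sets_sample_obs refl])
  show "AE z in sample (obs \<theta>) k. norm (full_gain k \<theta> z) \<le> norm (Tsum k z)"
    using full_gain_bounds by (intro AE_I2) (force simp: space_sample_obs)
qed

text \<open>Brings the extended integral of (A4) into real form; the gain is nonnegative, so
  truncation by \<open>ennreal\<close> loses nothing.\<close>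

lemma nn_integral_full_gain:
  assumes T: "integrable (obs \<theta>) T"
  shows "(\<integral>\<^sup>+ z. ennreal (lik p k \<theta> z * ln (lik p k (mle k z) z / lik p k \<theta> z)) \<partial>sample \<mu> k)
    = ennreal (\<integral>z. full_gain k \<theta> z \<partial>sample (obs \<theta>) k)"
proof -
  have th': "\<theta> \<in> \<Theta>" using th K_subset by auto
  have "(\<integral>\<^sup>+ z. ennreal (lik p k \<theta> z * ln (lik p k (mle k z) z / lik p k \<theta> z)) \<partial>sample \<mu> k)
      = (\<integral>\<^sup>+ z. ennreal (lik p k \<theta> z) * ennreal (full_gain k \<theta> z) \<partial>sample \<mu> k)"
  proof (intro nn_integral_cong)
    fix z assume z: "z \<in> space (sample \<mu> k)"
    show "ennreal (lik p k \<theta> z * ln (lik p k (mle k z) z / lik p k \<theta> z)) = ennreal (lik p k \<theta> z) * ennreal (full_gain k \<theta> z)"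
      using lik_pos[OF th z] lik_mle_pos[OF z] full_gain_bounds(1)[OF z]
      by (simp add: ennreal_mult[symmetric] full_gain_def ln_div)
  qed
  also have "\<dots> = (\<integral>\<^sup>+ z. ennreal (full_gain k \<theta> z) \<partial>sample (obs \<theta>) k)"
    unfolding density_lik[OF th', symmetric]
    using full_gain_measurable lik_measurable[OF th'] by (intro nn_integral_density[symmetric]) auto
  also have "\<dots> = ennreal (\<integral>z. full_gain k \<theta> z \<partial>sample (obs \<theta>) k)"
    using full_gain_bounds(1) by (intro nn_integral_eq_integral integrable_full_gain T AE_I2) (auto simp: space_sample_obs)
  finally show ?thesis .
qed

end

text \<open>Holds pointwise: the joint MLE is a point of \<Theta>, hence a competitor of the
  maximiser for y alone.\<close>

lemma log_gain_le:
  assumes M: "M \<ge> 1" and th: "\<theta> \<in> K" and T: "integrable (obs \<theta>) T"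
  shows "(\<integral>xy. log_gain N M \<theta> xy \<partial>pair_obs N M \<theta>) \<le> (\<integral>y. full_gain M \<theta> y \<partial>sample (obs \<theta>) M)"
proof -
  have th': "\<theta> \<in> \<Theta>" using th K_subset by auto
  have NM: "N + M \<ge> 1" using M by simp
  note m = full_gain_measurable[OF M th]
  have "(\<integral>xy. log_gain N M \<theta> xy \<partial>pair_obs N M \<theta>) \<le> (\<integral>xy. full_gain M \<theta> (snd xy) \<partial>pair_obs N M \<theta>)"
  proof (rule integral_mono[OF integrable_log_gain[OF NM th T]])
    show "integrable (pair_obs N M \<theta>) (\<lambda>xy. full_gain M \<theta> (snd xy))"
      using integrable_pair_obs_snd[OF th' m] integrable_full_gain[OF M th T] by simp
    fix xy assume "xy \<in> space (pair_obs N M \<theta>)"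
    then have xy: "fst xy \<in> space (sample \<mu> N)" "snd xy \<in> space (sample \<mu> M)"
      by (auto simp: space_pair_measure space_sample_obs)
    have "ln (lik p M (cmle N M (fst xy) (snd xy)) (snd xy)) \<le> ln (lik p M (mle M (snd xy)) (snd xy))"
      using lik_cmle_pos(2)[OF NM th xy] mle_max[OF M xy(2) cmle_in[OF NM th xy]] by (intro ln_mono) auto
    then show "log_gain N M \<theta> xy \<le> full_gain M \<theta> (snd xy)"
      by (simp add: log_gain_def full_gain_def)
  qed
  also have "\<dots> = (\<integral>y. full_gain M \<theta> y \<partial>sample (obs \<theta>) M)" by (rule integral_pair_obs_snd[OF th' m])
  finally show ?thesis .
qed

text \<open>A single majorant for two cases. Within \<eta> of \<theta> both parameters lie in the
  \<delta>-neighbourhood of K and the Lipschitz bound applies; otherwise T is split into its excess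
  over \<open>c\<close> and at most \<open>c\<close>, the latter weighted by the far event.\<close>

lemma ln_p_mle_le:
  assumes k: "k \<ge> 1" and th: "\<theta> \<in> K" and z: "z \<in> space (sample \<mu> k)" and i: "i < k" and eta: "\<eta> \<le> \<delta>" and c: "0 \<le> c"
    and delta: "0 \<le> \<delta>"
    and L0: "\<And>z. z \<in> space \<mu> \<Longrightarrow> 0 \<le> L z"
    and lip: "\<And>z \<theta>1 \<theta>2. z \<in> space \<mu> \<Longrightarrow>
        \<theta>1 \<in> {\<theta>'\<in>\<Theta>. \<exists>\<theta>\<in>K. norm (\<theta> - \<theta>') \<le> \<delta>} \<Longrightarrow>
        \<theta>2 \<in> {\<theta>'\<in>\<Theta>. \<exists>\<theta>\<in>K. norm (\<theta> - \<theta>') \<le> \<delta>} \<Longrightarrow>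
        \<bar>ln (p \<theta>1 z) - ln (p \<theta>2 z)\<bar> \<le> L z * norm (\<theta>1 - \<theta>2)"
    and eta0: "0 \<le> \<eta>"
  shows "0 < p (mle k z) (z i)"
    and "ln (p (mle k z) (z i)) - ln (p \<theta> (z i))
      \<le> \<eta> * L (z i) + max (T (z i) - c) 0 + c * indicator {z \<in> space (sample \<mu> k). norm (mle k z - \<theta>) > \<eta>} z"
proof -
  let ?m = "mle k z"
  have zi: "z i \<in> space \<mu>" by (rule sample_component[OF z i])
  have m: "?m \<in> \<Theta>" by (rule mle_in[OF k z])
  \<comment> \<open>A positive product has no vanishing factor; this later permits splitting the
    logarithm of the product.\<close>
  have "p ?m (z i) \<noteq> 0"
    using lik_mle_pos[OF k th z] i unfolding lik_def by (auto simp: prod_zero_iff dest: less_imp_neq)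
  then show pos: "0 < p ?m (z i)" using p_nonneg[OF m zi] by simp
  show "ln (p ?m (z i)) - ln (p \<theta> (z i))
      \<le> \<eta> * L (z i) + max (T (z i) - c) 0 + c * indicator {z \<in> space (sample \<mu> k). norm (mle k z - \<theta>) > \<eta>} z"
  proof (cases "norm (?m - \<theta>) \<le> \<eta>")
    case True
    have "?m \<in> {\<theta>'\<in>\<Theta>. \<exists>\<theta>\<in>K. norm (\<theta> - \<theta>') \<le> \<delta>}"
      using m th True eta by (auto simp: norm_minus_commute intro!: bexI[of _ \<theta>])
    moreover have "\<theta> \<in> {\<theta>'\<in>\<Theta>. \<exists>\<theta>\<in>K. norm (\<theta> - \<theta>') \<le> \<delta>}"
      using th K_subset delta by (auto intro!: bexI[of _ \<theta>])
    ultimately have "ln (p ?m (z i)) - ln (p \<theta> (z i)) \<le> L (z i) * norm (?m - \<theta>)"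
      using lip[OF zi, of ?m \<theta>] by (meson abs_le_D1)
    also have "\<dots> \<le> \<eta> * L (z i)"
      using mult_left_mono[OF True L0[OF zi]] by (simp add: mult.commute)
    finally show ?thesis using c by (auto simp: indicator_def)
  next
    case False
    have "ln (p ?m (z i)) \<le> ln (exp (T (z i)) * p \<theta> (z i))"
      using pos p_le[OF m th zi] by (intro ln_mono) auto
    then have "ln (p ?m (z i)) - ln (p \<theta> (z i)) \<le> T (z i)"
      using p_pos[OF th zi] by (simp add: ln_mult)
    moreover have "indicator {z \<in> space (sample \<mu> k). norm (mle k z - \<theta>) > \<eta>} z = (1::real)"
      using False z by simp
    moreover have "0 \<le> \<eta> * L (z i)" using eta0 L0[OF zi] by simp
    ultimately show ?thesis by (simp add: max_def)
  qed
qed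

text \<open>The gain on y is the gain on the whole sample minus that on x. The latter is a sum of N
  terms, each with the majorant of \<open>ln_p_mle_le\<close>, so the error carries the fixed factor
  N whatever M is.\<close>

lemma log_gain_ge:
  assumes NM: "N + M \<ge> 1" and th: "\<theta> \<in> K" and T: "integrable (obs \<theta>) T"
    and eta: "0 \<le> \<eta>" "\<eta> \<le> \<delta>" and c: "0 \<le> c"
    and L: "integrable (obs \<theta>) L" and L_meas: "L \<in> borel_measurable \<mu>"
    and L0: "\<And>z. z \<in> space \<mu> \<Longrightarrow> 0 \<le> L z"
    and lip: "\<And>z \<theta>1 \<theta>2. z \<in> space \<mu> \<Longrightarrow>
        \<theta>1 \<in> {\<theta>'\<in>\<Theta>. \<exists>\<theta>\<in>K. norm (\<theta> - \<theta>') \<le> \<delta>} \<Longrightarrow>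
        \<theta>2 \<in> {\<theta>'\<in>\<Theta>. \<exists>\<theta>\<in>K. norm (\<theta> - \<theta>') \<le> \<delta>} \<Longrightarrow>
        \<bar>ln (p \<theta>1 z) - ln (p \<theta>2 z)\<bar> \<le> L z * norm (\<theta>1 - \<theta>2)"
    and Tc: "integrable (obs \<theta>) (\<lambda>z. max (T z - c) 0)"
  shows "(\<integral>xy. log_gain N M \<theta> xy \<partial>pair_obs N M \<theta>)
    \<ge> (\<integral>z. full_gain (N + M) \<theta> z \<partial>sample (obs \<theta>) (N + M))
      - real N * (\<eta> * (\<integral>z. L z \<partial>obs \<theta>) + (\<integral>z. max (T z - c) 0 \<partial>obs \<theta>)
          + c * measure (sample (obs \<theta>) (N + M)) {z \<in> space (sample \<mu> (N + M)). norm (mle (N + M) z - \<theta>) > \<eta>})"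
proof -
  have th': "\<theta> \<in> \<Theta>" using th K_subset by auto
  interpret P: prob_space "sample (obs \<theta>) (N + M)" by (intro prob_space_sample prob_obs th')
  let ?A = "{z \<in> space (sample \<mu> (N + M)). norm (mle (N + M) z - \<theta>) > \<eta>}"
  define w where "w i z = \<eta> * L (z i) + max (T (z i) - c) 0 + c * indicator ?A z" for i z
  define u where "u z = full_gain (N + M) \<theta> z - (\<Sum>i<N. w i z)" for z
  have A: "?A \<in> sets (sample (obs \<theta>) (N + M))" by (rule mle_far_measurable[OF NM])
  have Tc_meas: "(\<lambda>z. max (T z - c) 0) \<in> borel_measurable \<mu>" using T_meas by measurable
  \<comment> \<open>The coordinates are identically distributed, so the mean of \<open>w i\<close>
    does not depend on i and the sum contributes N equal terms.\<close>
  have w: "integrable (sample (obs \<theta>) (N + M)) (w i)"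
    "(\<integral>z. w i z \<partial>sample (obs \<theta>) (N + M)) = \<eta> * (\<integral>z. L z \<partial>obs \<theta>) + (\<integral>z. max (T z - c) 0 \<partial>obs \<theta>)
        + c * measure (sample (obs \<theta>) (N + M)) ?A" if "i < N" for i
  proof -
    have i: "i < N + M" using that by simp
    have 1: "integrable (sample (obs \<theta>) (N + M)) (\<lambda>z. L (z i))"
      using integrable_obs_component[OF th' i L_meas] L by simp
    have 2: "integrable (sample (obs \<theta>) (N + M)) (\<lambda>z. max (T (z i) - c) 0)"
      using integrable_obs_component[OF th' i Tc_meas] Tc by simp
    have 3: "integrable (sample (obs \<theta>) (N + M)) (indicator ?A :: _ \<Rightarrow> real)"
      using A by (intro integrable_real_indicator) (auto simp: P.emeasure_eq_measure)
    show "integrable (sample (obs \<theta>) (N + M)) (w i)"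
      unfolding w_def by (intro Bochner_Integration.integrable_add integrable_mult_right 1 2 3)
    show "(\<integral>z. w i z \<partial>sample (obs \<theta>) (N + M)) = \<eta> * (\<integral>z. L z \<partial>obs \<theta>) + (\<integral>z. max (T z - c) 0 \<partial>obs \<theta>)
        + c * measure (sample (obs \<theta>) (N + M)) ?A"
      unfolding w_def using 1 2 3 A sets.sets_into_space[OF A]
      by (simp add: integral_obs_component[OF th' i L_meas] integral_obs_component[OF th' i Tc_meas] Int_absorb2)
  qed
  have wm: "w i \<in> borel_measurable (sample \<mu> (N + M))" if "i < N" for i
    using borel_measurable_integrable[OF w(1)[OF that]] by (simp add: measurable_cong_sets[OF sets_sample_obs refl])
  have u_meas: "u \<in> borel_measurable (sample \<mu> (N + M))"
    unfolding u_def using wm full_gain_measurable[OF NM th] by (intro borel_measurable_diff borel_measurable_sum) auto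
  have u_int: "integrable (sample (obs \<theta>) (N + M)) u"
    unfolding u_def using w integrable_full_gain[OF NM th T]
    by (intro Bochner_Integration.integrable_diff Bochner_Integration.integrable_sum) auto
  have "(\<integral>z. full_gain (N + M) \<theta> z \<partial>sample (obs \<theta>) (N + M))
      - real N * (\<eta> * (\<integral>z. L z \<partial>obs \<theta>) + (\<integral>z. max (T z - c) 0 \<partial>obs \<theta>)
          + c * measure (sample (obs \<theta>) (N + M)) ?A) = (\<integral>z. u z \<partial>sample (obs \<theta>) (N + M))"
    unfolding u_def using w integrable_full_gain[OF NM th T]
    by (subst Bochner_Integration.integral_diff) (auto simp: Bochner_Integration.integral_sum)
  \<comment> \<open>From here on the comparison is pointwise in (x, y); x occupies the first N
    coordinates of the concatenated sample.\<close>
  also have "\<dots> = (\<integral>(x, y). u (concat N M x y) \<partial>pair_obs N M \<theta>)"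
    by (rule integral_pair_obs_concat[OF th' u_meas, symmetric])
  also have "\<dots> \<le> (\<integral>xy. log_gain N M \<theta> xy \<partial>pair_obs N M \<theta>)"
  proof (rule integral_mono)
    show "integrable (pair_obs N M \<theta>) (\<lambda>(x, y). u (concat N M x y))"
      using integrable_pair_obs_concat[OF th' u_meas] u_int by simp
    show "integrable (pair_obs N M \<theta>) (log_gain N M \<theta>)" by (rule integrable_log_gain[OF NM th T])
    fix xy assume "xy \<in> space (pair_obs N M \<theta>)"
    moreover obtain x y where xy[simp]: "xy = (x, y)" by (cases xy)
    ultimately have x: "x \<in> space (sample \<mu> N)" and y: "y \<in> space (sample \<mu> M)"
      by (auto simp: space_pair_measure space_sample_obs)
    let ?z = "concat N M x y"
    let ?m = "mle (N + M) ?z"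
    have z: "?z \<in> space (sample \<mu> (N + M))" by (rule concat_in_space[OF x y])
    have zi: "?z i = x i" if "i < N" for i using that by (simp add: concat_def)
    have pm: "0 < p ?m (x i)" and le: "ln (p ?m (x i)) - ln (p \<theta> (x i)) \<le> w i ?z" if "i < N" for i
      using ln_p_mle_le[OF NM th z _ eta(2) c _ L0 lip eta(1), of i] eta that zi[OF that]
      by (auto simp: w_def)
    have p\<theta>: "0 < p \<theta> (x i)" if "i < N" for i by (rule p_pos[OF th sample_component[OF x that]])
    have ln_lik: "ln (lik p N \<phi> x) = (\<Sum>i<N. ln (p \<phi> (x i)))" if "\<And>i. i < N \<Longrightarrow> 0 < p \<phi> (x i)" for \<phi>
      unfolding lik_def by (rule ln_prod[OF finite_lessThan]) (metis lessThan_iff less_irrefl that)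
    have "ln (lik p N ?m x) - ln (lik p N \<theta> x) = (\<Sum>i<N. ln (p ?m (x i)) - ln (p \<theta> (x i)))"
      using ln_lik[of ?m] ln_lik[of \<theta>] pm p\<theta> by (simp add: sum_subtractf)
    also have "\<dots> \<le> (\<Sum>i<N. w i ?z)" using le by (intro sum_mono) auto
    finally have "ln (lik p N ?m x) - ln (lik p N \<theta> x) \<le> (\<Sum>i<N. w i ?z)" .
    \<comment> \<open>Additivity of the log-likelihood over x and y, with the same estimator in both
      parts.\<close>
    moreover have "full_gain (N + M) \<theta> ?z
        = (ln (lik p N ?m x) - ln (lik p N \<theta> x)) + log_gain N M \<theta> xy"
      using lik_cmle_pos[OF NM th x y] lik_pos[OF th x] lik_pos[OF th y]
      by (simp add: full_gain_def log_gain_def lik_concat ln_mult)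
    ultimately show "(case xy of (x, y) \<Rightarrow> u (concat N M x y)) \<le> log_gain N M \<theta> xy"
      by (simp add: u_def)
  qed
  finally show ?thesis .
qed

end

section \<open>Choice of constants and passage to the limit\<close>

theorem theorem1:
  fixes \<mu> :: "'x measure"
    and p :: "'a::euclidean_space \<Rightarrow> 'x \<Rightarrow> real"
    and \<Theta> K :: "'a set"
    and mle :: "nat \<Rightarrow> (nat \<Rightarrow> 'x) \<Rightarrow> 'a"
    and \<delta> :: real
    and L T :: "'x \<Rightarrow> real"
    and \<alpha> r :: ereal
    and N :: nat
    and C :: "nat \<Rightarrow> real"
  assumes sigma_fin: "sigma_finite_measure \<mu>"
    \<comment> \<open>densities\<close>
    and p_meas: "(\<lambda>(\<theta>, z). p \<theta> z) \<in> borel_measurable (restrict_space borel \<Theta> \<Otimes>\<^sub>M \<mu>)"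
    and p_nonneg: "\<And>\<theta> z. \<theta> \<in> \<Theta> \<Longrightarrow> z \<in> space \<mu> \<Longrightarrow> 0 \<le> p \<theta> z"
    and p_prob: "\<And>\<theta>. \<theta> \<in> \<Theta> \<Longrightarrow> (\<integral>\<^sup>+ z. ennreal (p \<theta> z) \<partial>\<mu>) = 1"
    \<comment> \<open>maximum likelihood estimator\<close>
    and mle_meas: "\<And>k. k \<ge> 1 \<Longrightarrow> mle k \<in> borel_measurable (sample \<mu> k)"
    and mle_in: "\<And>k z. k \<ge> 1 \<Longrightarrow> z \<in> space (sample \<mu> k) \<Longrightarrow> mle k z \<in> \<Theta>"
    and mle_max: "\<And>k z \<theta>. k \<ge> 1 \<Longrightarrow> z \<in> space (sample \<mu> k) \<Longrightarrow> \<theta> \<in> \<Theta> \<Longrightarrow>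
                    lik p k \<theta> z \<le> lik p k (mle k z) z"
    \<comment> \<open>K and K_delta\<close>
    and K_compact: "compact K"
    and K_int: "K \<subseteq> interior \<Theta>"
    and p_pos: "\<And>\<theta> z. \<theta> \<in> K \<Longrightarrow> z \<in> space \<mu> \<Longrightarrow> 0 < p \<theta> z"
    and delta_pos: "\<delta> > 0"
    and K_delta: "{\<theta>'\<in>\<Theta>. \<exists>\<theta>\<in>K. norm (\<theta> - \<theta>') \<le> \<delta>} \<subseteq> interior \<Theta>"
    \<comment> \<open>(A1)\<close>
    and L_meas: "L \<in> borel_measurable \<mu>"
    and L_nonneg: "\<And>z. z \<in> space \<mu> \<Longrightarrow> 0 \<le> L z"
    and alpha_ge: "1 \<le> \<alpha>"
    and A1_lip: "\<And>z \<theta>1 \<theta>2. z \<in> space \<mu> \<Longrightarrow>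
        \<theta>1 \<in> {\<theta>'\<in>\<Theta>. \<exists>\<theta>\<in>K. norm (\<theta> - \<theta>') \<le> \<delta>} \<Longrightarrow>
        \<theta>2 \<in> {\<theta>'\<in>\<Theta>. \<exists>\<theta>\<in>K. norm (\<theta> - \<theta>') \<le> \<delta>} \<Longrightarrow>
        \<bar>ln (p \<theta>1 z) - ln (p \<theta>2 z)\<bar> \<le> L z * norm (\<theta>1 - \<theta>2)"
    and A1_mom: "moment_bound \<mu> p K L \<alpha>"
    \<comment> \<open>(A2)\<close>
    and A2: "A2_cond \<mu> p K mle (conj_exp \<alpha>)"
    \<comment> \<open>(A3)\<close>
    and T_meas: "T \<in> borel_measurable \<mu>"
    and T_nonneg: "\<And>z. z \<in> space \<mu> \<Longrightarrow> 0 \<le> T z"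
    and r_gt: "1 < r"
    and A3_bound: "\<And>z \<theta>. z \<in> space \<mu> \<Longrightarrow> \<theta> \<in> K \<Longrightarrow>
        ln (p (mle 1 (single z)) z) - ln (p \<theta> z) \<le> T z"
    and A3_mom: "moment_bound \<mu> p K T r"
    \<comment> \<open>(A4)\<close>
    and A4: "\<And>\<epsilon>. \<epsilon> > 0 \<Longrightarrow> eventually (\<lambda>k. \<forall>\<theta>\<in>K.
        \<bar>enn2ereal (\<integral>\<^sup>+ z. ennreal (lik p k \<theta> z * ln (lik p k (mle k z) z / lik p k \<theta> z))
                       \<partial>sample \<mu> k) - ereal (real DIM('a) / 2)\<bar> \<le> ereal \<epsilon>) sequentially"
    \<comment> \<open>CNML3 is well defined (finite normaliser)\<close>
    and norm_fin: "\<And>M x. x \<in> space (sample \<mu> N) \<Longrightarrow> cnml3_norm \<mu> p mle N M x < \<infinity>"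
    \<comment> \<open>(A5)\<close>
    and A5: "\<And>\<epsilon>. \<epsilon> > 0 \<Longrightarrow> eventually (\<lambda>M. \<forall>\<theta>\<in>K.
        integrable (sample \<mu> N) (\<lambda>x. lik p N \<theta> x * ln (enn2real (cnml3_norm \<mu> p mle N M x))) \<and>
        \<bar>(\<integral>x. lik p N \<theta> x * ln (enn2real (cnml3_norm \<mu> p mle N M x)) \<partial>sample \<mu> N) - C M\<bar> \<le> \<epsilon>)
        sequentially"
  shows "\<forall>\<epsilon>>0. eventually (\<lambda>M. \<forall>\<pi>\<in>priors K.
      integrable (sample \<mu> N \<Otimes>\<^sub>M sample \<mu> M) (Dq_integrand p \<pi> (q_cnml3 \<mu> p mle N M) N M) \<and>
      integrable (\<pi> \<Otimes>\<^sub>M (sample \<mu> N \<Otimes>\<^sub>M sample \<mu> M)) (KL_bayes_integrand p \<pi> N M) \<and>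
      \<bar>Dq \<mu> p \<pi> (q_cnml3 \<mu> p mle N M) N M + KL_risk_bayes \<mu> p \<pi> N M
        - (C M - real DIM('a) / 2)\<bar> \<le> \<epsilon>) sequentially"
proof (intro allI impI)
  fix \<epsilon> :: real assume eps: "\<epsilon> > 0"
  have eps4: "\<epsilon> / 4 > 0" and eps2: "\<epsilon> / 2 > 0" using eps by simp_all
  have K_sub: "K \<subseteq> \<Theta>" using K_int interior_subset by blast
  interpret mle_model \<mu> p \<Theta> K mle T
    by (rule mle_model.intro; (rule sigma_fin p_meas p_nonneg p_prob mle_meas mle_in mle_max K_sub p_pos
        T_meas T_nonneg A3_bound; assumption))
  define d where "d = real DIM('a) / 2"
  \<comment> \<open>Each of the three errors per observation of x will be at most \<kappa>;
    together, over N observations, they cost at most \<epsilon>/4.\<close>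
  define \<kappa> where "\<kappa> = \<epsilon> / (12 * (real N + 1))"
  have kap: "\<kappa> > 0" and Nkap: "real N * (3 * \<kappa>) \<le> \<epsilon> / 4"
    using eps by (auto simp: \<kappa>_def field_simps)
  obtain \<tau> where "0 \<le> \<tau>" and Tint: "\<And>\<theta>. \<theta> \<in> K \<Longrightarrow> integrable (obs \<theta>) T"
    and Tb: "\<And>\<theta>. \<theta> \<in> K \<Longrightarrow> (\<integral>z. T z \<partial>obs \<theta>) \<le> \<tau>"
    using moment_integrable[OF A3_mom less_imp_le[OF r_gt] T_meas T_nonneg] by blast
  obtain c where c: "0 \<le> c" and Tc: "\<And>\<theta>. \<theta> \<in> K \<Longrightarrow> integrable (obs \<theta>) (\<lambda>z. max (T z - c) 0)"
    and Tcb: "\<And>\<theta>. \<theta> \<in> K \<Longrightarrow> (\<integral>z. max (T z - c) 0 \<partial>obs \<theta>) \<le> \<kappa>"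
    using moment_uniformly_integrable[OF A3_mom r_gt T_meas T_nonneg kap] by blast
  obtain l where l: "0 \<le> l" and Lint: "\<And>\<theta>. \<theta> \<in> K \<Longrightarrow> integrable (obs \<theta>) L"
    and Lb: "\<And>\<theta>. \<theta> \<in> K \<Longrightarrow> (\<integral>z. L z \<partial>obs \<theta>) \<le> l"
    using moment_integrable[OF A1_mom alpha_ge L_meas L_nonneg] by blast
  \<comment> \<open>The radius stays in the Lipschitz neighbourhood and makes the Lipschitz error at
    most \<kappa>; \<open>l + 1\<close> avoids division by zero.\<close>
  define \<eta> where "\<eta> = min \<delta> (\<kappa> / (l + 1))"
  have eta: "0 < \<eta>" "\<eta> \<le> \<delta>" "\<eta> \<le> \<kappa> / (l + 1)" using delta_pos kap l by (auto simp: \<eta>_def)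
  have "\<eta> * l \<le> \<kappa> / (l + 1) * (l + 1)" using eta l kap by (intro mult_mono) auto
  then have etal: "\<eta> * l \<le> \<kappa>" using l by simp
  \<comment> \<open>The admissible probability of the far event depends on the truncation level
    \<open>c\<close>, so it is fixed only after \<open>c\<close>.\<close>
  define s where "s = \<kappa> / (c + 1)"
  have s: "0 < s" using c kap by (simp add: s_def)
  have "c * s \<le> (c + 1) * s" using s by (intro mult_right_mono) auto
  then have cs: "c * s \<le> \<kappa>" using c by (simp add: s_def)

  have "eventually (\<lambda>k. \<forall>\<theta>\<in>K. \<bar>(\<integral>z. full_gain k \<theta> z \<partial>sample (obs \<theta>) k) - d\<bar> \<le> \<epsilon> / 4) sequentially"
    using A4[OF eps4] eventually_ge_at_top[of "1::nat"]
  proof eventually_elim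
    case (elim k)
    show ?case
    proof
      fix \<theta> assume th: "\<theta> \<in> K"
      have "0 \<le> (\<integral>z. full_gain k \<theta> z \<partial>sample (obs \<theta>) k)"
        using full_gain_bounds(1)[OF elim(2) th] by (intro integral_nonneg_AE AE_I2) (auto simp: space_sample_obs)
      then show "\<bar>(\<integral>z. full_gain k \<theta> z \<partial>sample (obs \<theta>) k) - d\<bar> \<le> \<epsilon> / 4"
        using bspec[OF elim(1) th] unfolding nn_integral_full_gain[OF elim(2) th Tint[OF th]]
        by (simp add: d_def)
    qed
  qed
  moreover have "eventually (\<lambda>k. \<forall>\<theta>\<in>K.
      measure (sample (obs \<theta>) k) {z \<in> space (sample \<mu> k). norm (mle k z - \<theta>) > \<eta>} \<le> s) sequentially"
    by (rule mle_consistent[OF A2 alpha_ge eta(1) s])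
  ultimately have "eventually (\<lambda>k. \<forall>\<theta>\<in>K. \<bar>(\<integral>z. full_gain k \<theta> z \<partial>sample (obs \<theta>) k) - d\<bar> \<le> \<epsilon> / 4 \<and>
      measure (sample (obs \<theta>) k) {z \<in> space (sample \<mu> k). norm (mle k z - \<theta>) > \<eta>} \<le> s) sequentially"
    by eventually_elim auto
  \<comment> \<open>An explicit threshold is extracted because the estimates are applied at two
    sample sizes, M and N + M.\<close>
  then obtain k0 where gain_k0: "\<And>k \<theta>. k \<ge> k0 \<Longrightarrow> \<theta> \<in> K \<Longrightarrow>
        \<bar>(\<integral>z. full_gain k \<theta> z \<partial>sample (obs \<theta>) k) - d\<bar> \<le> \<epsilon> / 4"
      and far_k0: "\<And>k \<theta>. k \<ge> k0 \<Longrightarrow> \<theta> \<in> K \<Longrightarrow>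
        measure (sample (obs \<theta>) k) {z \<in> space (sample \<mu> k). norm (mle k z - \<theta>) > \<eta>} \<le> s"
    unfolding eventually_sequentially by blast

  show "eventually (\<lambda>M. \<forall>\<pi>\<in>priors K.
      integrable (sample \<mu> N \<Otimes>\<^sub>M sample \<mu> M) (Dq_integrand p \<pi> (q_cnml3 \<mu> p mle N M) N M) \<and>
      integrable (\<pi> \<Otimes>\<^sub>M (sample \<mu> N \<Otimes>\<^sub>M sample \<mu> M)) (KL_bayes_integrand p \<pi> N M) \<and>
      \<bar>Dq \<mu> p \<pi> (q_cnml3 \<mu> p mle N M) N M + KL_risk_bayes \<mu> p \<pi> N M
        - (C M - real DIM('a) / 2)\<bar> \<le> \<epsilon>) sequentially"
    using A5[OF eps2] eventually_ge_at_top[of k0] eventually_ge_at_top[of "1::nat"]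
  proof eventually_elim
    case (elim M)
    have NM: "N + M \<ge> 1" "N + M \<ge> k0" using elim by auto
    \<comment> \<open>One \<epsilon>/4 comes from (A4), the other from the N observations in x,
      which affect the lower bound only. The remaining \<epsilon>/2 of the budget is left to
      (A5).\<close>
    have gain: "\<bar>(\<integral>xy. log_gain N M \<theta> xy \<partial>pair_obs N M \<theta>) - d\<bar> \<le> \<epsilon> / 2" if th: "\<theta> \<in> K" for \<theta>
    proof -
      let ?b = "measure (sample (obs \<theta>) (N + M)) {z \<in> space (sample \<mu> (N + M)). norm (mle (N + M) z - \<theta>) > \<eta>}"
      have "\<eta> * (\<integral>z. L z \<partial>obs \<theta>) \<le> \<kappa>"
        using mult_left_mono[OF Lb[OF th] less_imp_le[OF eta(1)]] etal by (rule order_trans)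
      moreover have "c * ?b \<le> \<kappa>"
        using mult_left_mono[OF far_k0[OF NM(2) th] c] cs by (rule order_trans)
      ultimately have "\<eta> * (\<integral>z. L z \<partial>obs \<theta>) + (\<integral>z. max (T z - c) 0 \<partial>obs \<theta>) + c * ?b \<le> 3 * \<kappa>"
        using Tcb[OF th] by linarith
      from order_trans[OF mult_left_mono[OF this of_nat_0_le_iff] Nkap]
      have "real N * (\<eta> * (\<integral>z. L z \<partial>obs \<theta>) + (\<integral>z. max (T z - c) 0 \<partial>obs \<theta>) + c * ?b) \<le> \<epsilon> / 4" .
      then show ?thesis
        using log_gain_ge[OF NM(1) th Tint[OF th] less_imp_le[OF eta(1)] eta(2) c Lint[OF th] L_meas L_nonneg A1_lip Tc[OF th]]
          log_gain_le[OF elim(3) th Tint[OF th], of N] gain_k0[OF NM(2) th] gain_k0[OF elim(2) th]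
        unfolding abs_le_iff by linarith
    qed
    show ?case
    proof
      fix \<pi> assume prior: "\<pi> \<in> priors K"
      note close = risk_sum_close[OF prior NM(1) norm_fin Tint Tb
        conjunct1[OF bspec[OF elim(1)]] conjunct2[OF bspec[OF elim(1)]] gain]
      show "integrable (pair_sample N M) (Dq_integrand p \<pi> (q_cnml3 \<mu> p mle N M) N M) \<and>
        integrable (\<pi> \<Otimes>\<^sub>M pair_sample N M) (KL_bayes_integrand p \<pi> N M) \<and>
        \<bar>Dq \<mu> p \<pi> (q_cnml3 \<mu> p mle N M) N M + KL_risk_bayes \<mu> p \<pi> N M - (C M - real DIM('a) / 2)\<bar> \<le> \<epsilon>"
        using close unfolding d_def by simp
    qed
  qed
qed

end
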